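(* There exist a Fréchet space $X$ and a continuous linear operator $T:X\to X$ which is log-frequently hypercyclic but not frequently hypercyclic.
   Context: $\mathbb{N}$ denotes the set of positive integers. For $E\subset\mathbb{N}$, the natural lower density is $\underline{d}(E)=\liminf_{n\to\infty}\frac1n\#(E\cap\{1,\dots,n\})$, and the lower logarithmic density is $\underline{d}_{log}(E)=\liminf_{n\to\infty}\left(\sum_{k=1}^n\frac1k\mathbf{1}_E(k)\right)\Big/\left(\sum_{j=1}^n\frac1j\right)$. A continuous linear operator $T:X\to X$ is frequently hypercyclic (respectively log-frequently hypercyclic) if there exists $x\in X$ such that for every non-empty open set $U\subset X$ the set $\{n\in\mathbb{N}:T^nx\in U\}$ has positive natural lower density $\underline{d}$ (respectively positive lower logarithmic density $\underline{d}_{log}$). *)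

theory Defs
  imports "HOL-Analysis.Analysis" "HOL-Library.Function_Algebras"
begin

text \<open>
  Fr\'echet spaces, as locally convex topological vector spaces whose topology is induced by a
  complete translation-invariant metric. The underlying vector space is \<open>topspace X\<close>, a linear
  subspace of an ambient vector space \<open>'a\<close>; \<open>X\<close> need not be related to any topology on \<open>'a\<close>.
\<close>

locale frechet_space = vector_space scale
  for scale :: "'k::real_normed_field \<Rightarrow> 'a::ab_group_add \<Rightarrow> 'a" +
  fixes X :: "'a topology"
  assumes subspace_topspace: "subspace (topspace X)"
    and continuous_add:
      "continuous_map (prod_topology X X) X (\<lambda>(x, y). x + y)"
    and continuous_scale:
      "continuous_map (prod_topology euclidean X) X (\<lambda>(c, x). scale c x)"
    and locally_convex:
      "\<And>U. openin X U \<Longrightarrow> 0 \<in> U \<Longrightarrow>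
        \<exists>V. openin X V \<and> 0 \<in> V \<and> V \<subseteq> U \<and>
          (\<forall>x\<in>V. \<forall>y\<in>V. \<forall>t\<in>{0..1::real}.
            scale (of_real (1 - t)) x + scale (of_real t) y \<in> V)"
    and complete_invariant_metric:
      "\<exists>d. Metric_space (topspace X) d \<and>
        Metric_space.mtopology (topspace X) d = X \<and>
        Metric_space.mcomplete (topspace X) d \<and>
        (\<forall>x\<in>topspace X. \<forall>y\<in>topspace X. \<forall>z\<in>topspace X. d (x + z) (y + z) = d x y)"

text \<open>Only the values of \<open>T\<close> on \<open>topspace X\<close> matter.\<close>

definition continuous_linear_operator ::
    "('k \<Rightarrow> 'a \<Rightarrow> 'a) \<Rightarrow> 'a::ab_group_add topology \<Rightarrow> ('a \<Rightarrow> 'a) \<Rightarrow> bool" where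
  "continuous_linear_operator s X T \<longleftrightarrow>
    continuous_map X X T \<and>
    (\<forall>x\<in>topspace X. \<forall>y\<in>topspace X. T (x + y) = T x + T y) \<and>
    (\<forall>c. \<forall>x\<in>topspace X. T (s c x) = s c (T x))"

text \<open>
  Densities of sets of positive integers. An element \<open>0\<close> of \<open>E\<close> is ignored, and so is the junk
  value \<open>0 / 0 = 0\<close> at \<open>n = 0\<close>.
\<close>

definition lower_density :: "nat set \<Rightarrow> ereal" where
  "lower_density E = liminf (\<lambda>n. ereal (real (card (E \<inter> {1..n})) / real n))"

definition lower_log_density :: "nat set \<Rightarrow> ereal" where
  "lower_log_density E =
    liminf (\<lambda>n. ereal ((\<Sum>k=1..n. 1 / real k * indicator E k) / (\<Sum>j=1..n. 1 / real j)))"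

definition frequently_hypercyclic :: "'a topology \<Rightarrow> ('a \<Rightarrow> 'a) \<Rightarrow> bool" where
  "frequently_hypercyclic X T \<longleftrightarrow>
    (\<exists>x\<in>topspace X. \<forall>U. openin X U \<and> U \<noteq> {} \<longrightarrow>
      lower_density {n. n \<ge> 1 \<and> (T ^^ n) x \<in> U} > 0)"

definition log_frequently_hypercyclic :: "'a topology \<Rightarrow> ('a \<Rightarrow> 'a) \<Rightarrow> bool" where
  "log_frequently_hypercyclic X T \<longleftrightarrow>
    (\<exists>x\<in>topspace X. \<forall>U. openin X U \<and> U \<noteq> {} \<longrightarrow>
      lower_log_density {n. n \<ge> 1 \<and> (T ^^ n) x \<in> U} > 0)"

text \<open>
  Scalar multiplication on the space of scalar sequences. A Fr\'echet space carrying an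
  operator with a dense orbit is separable, so countably many continuous functionals separate its
  points and embed it linearly in the space of sequences. Hence subspaces of the latter, with
  arbitrary Fr\'echet topologies, represent all the spaces that matter here up to isomorphism.
\<close>

definition seq_scale :: "'k::field \<Rightarrow> (nat \<Rightarrow> 'k) \<Rightarrow> nat \<Rightarrow> 'k" where
  "seq_scale c x = (\<lambda>n. c * x n)"

lemma vector_space_seq_scale: "vector_space seq_scale"
  by unfold_locales (auto simp: seq_scale_def fun_eq_iff algebra_simps)

end

theory Submission
  imports Defs "HOL-Computational_Algebra.Factorial_Ring"
begin

text \<open>
  The operator is the backward shift \<open>B\<close> on the Banach space of all sequences \<open>x\<close> with
  \<open>x n / 2 ^ h n \<longlonglongrightarrow> 0\<close>, normed by \<open>SUP n. norm (x n) / 2 ^ h n\<close>. The shift is bounded because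
  \<open>h (n + 1) \<le> h n + 1\<close>; everything depends on the choice of the exponent \<open>h\<close> (\<open>height\<close> below).

  Why there is no frequently hypercyclic vector: the coordinate \<open>0\<close> of the \<open>n\<close>-th iterate of \<open>x\<close> is
  \<open>x n\<close>. If it stays away from \<open>0\<close> for \<open>n \<in> E\<close>, then \<open>h\<close> tends to infinity along \<open>E\<close>. So it
  suffices that the lower densities of the sets \<open>{n. s \<le> h n}\<close> tend to \<open>0\<close> as \<open>s\<close> grows.

  Why there is a log-frequently hypercyclic vector: let \<open>y p\<close> run through a dense sequence of
  vectors, \<open>y p\<close> being supported in \<open>{0..p}\<close>, and let \<open>x\<close> consist of disjoint copies of these
  vectors, each copy of \<open>y p\<close> starting at a point labelled \<open>p\<close>. If \<open>n\<close> is labelled \<open>p\<close>, then the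
  \<open>n\<close>-th iterate of \<open>x\<close> is \<open>y p\<close> plus a tail made of the copies that start at some \<open>n' > n\<close>. If
  \<open>n'\<close> is labelled \<open>q\<close>, then that copy sits at \<open>n' - n + {0..q}\<close>, and it is negligible if \<open>h\<close> is at
  least \<open>p + q\<close> there. Hence \<open>h\<close> must be large at the differences of starting points, which have
  to form, for each label, a set of positive lower logarithmic density.

  These requirements are compatible. The \<open>l\<close>-th window is the interval from \<open>2 ^ (2 ^ l + l)\<close> to
  \<open>2 ^ 2 ^ (l + 1)\<close>. In front of it lies a gap, of length about \<open>2 ^ l\<close> times the preceding
  window end: long enough to make the union of the windows a set of lower density \<open>0\<close>, but
  invisible on the logarithmic scale, where the windows themselves double in length. The starting
  points labelled \<open>p\<close> are the multiples of \<open>16 ^ p\<close> in the windows whose number has \<open>2\<close>-adic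
  valuation \<open>p\<close>. Such windows recur at bounded distance, so a fixed proportion of the logarithmic
  mass of \<open>{1..N}\<close> is in the latest one (\<open>lower_log_density_pos\<close>). Two starting points in the same
  window differ by a multiple of \<open>16 ^ p\<close>. Two in different windows differ by a number that
  essentially belongs to the later window, since that window starts far beyond the end of the
  earlier one. So \<open>h\<close> need only be large close to the windows and, to the extent \<open>2 * p\<close>, just
  after the multiples of \<open>16 ^ p\<close> (\<open>high_diff\<close>). The latter places have density of order \<open>4 ^ - s\<close>
  for \<open>p \<ge> s\<close>, and so the sets \<open>{n. 2 * s \<le> h n}\<close> are indeed sparse when seen from a point late
  in a gap (\<open>lower_density_le_0_if_height_to_infinity\<close>).
\<close>

section \<open>Complete normed subspaces are Frechet spaces\<close>

text \<open>
  The norm is a function on the whole ambient space: \<open>Metric_space\<close> wants a distance that is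
  nonnegative and symmetric also outside of its carrier, so two axioms are not relativised to \<open>M\<close>.
\<close>

locale complete_normed_subspace = vector_space scale
  for scale :: "'k::real_normed_field \<Rightarrow> 'a::ab_group_add \<Rightarrow> 'a" +
  fixes M :: "'a set" and N :: "'a \<Rightarrow> real"
  assumes subspace_M: "subspace M"
    and N_nonneg: "0 \<le> N x"
    and N_minus: "N (- x) = N x"
    and N_eq_0: "x \<in> M \<Longrightarrow> N x = 0 \<longleftrightarrow> x = 0"
    and N_triangle: "x \<in> M \<Longrightarrow> y \<in> M \<Longrightarrow> N (x + y) \<le> N x + N y"
    and N_scale: "x \<in> M \<Longrightarrow> N (scale c x) = norm c * N x"
    and N_complete: "range f \<subseteq> M \<Longrightarrow> (\<And>e. 0 < e \<Longrightarrow> \<exists>n0. \<forall>m\<ge>n0. \<forall>n\<ge>n0. N (f m - f n) < e) \<Longrightarrow>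
      \<exists>x\<in>M. (\<lambda>n. N (f n - x)) \<longlonglongrightarrow> 0"
begin

lemmas M_closed [simp] = subspace_add [OF subspace_M] subspace_diff [OF subspace_M]
  subspace_scale [OF subspace_M] subspace_0 [OF subspace_M]

sublocale Metric_space M "\<lambda>x y. N (x - y)"
proof
  show "N (x - y) = N (y - x)" for x y
    using N_minus [of "x - y"] by simp
  show "N (x - z) \<le> N (x - y) + N (y - z)" if "x \<in> M" "y \<in> M" "z \<in> M" for x y z
    using N_triangle [of "x - y" "y - z"] that by simp
qed (auto simp: N_nonneg N_eq_0)

lemma N_0 [simp]: "N 0 = 0"
  by (simp add: N_eq_0)

lemma continuous_map_into_mtopology:
  assumes "\<And>x. x \<in> topspace Y \<Longrightarrow> f x \<in> M"
    and "\<And>x e. x \<in> topspace Y \<Longrightarrow> 0 < e \<Longrightarrow>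
      \<exists>W. openin Y W \<and> x \<in> W \<and> (\<forall>y\<in>W. N (f x - f y) < e)"
  shows "continuous_map Y mtopology f"
  unfolding continuous_map_def
proof (intro conjI allI impI)
  show "f \<in> topspace Y \<rightarrow> topspace mtopology"
    using assms(1) by simp
  fix U assume U: "openin mtopology U"
  show "openin Y {x \<in> topspace Y. f x \<in> U}"
  proof (subst openin_subopen, intro ballI)
    fix x assume x: "x \<in> {x \<in> topspace Y. f x \<in> U}"
    then obtain r where r: "r > 0" "mball (f x) r \<subseteq> U"
      using U by (auto simp: openin_mtopology)
    obtain W where W: "openin Y W" "x \<in> W" "\<forall>y\<in>W. N (f x - f y) < r"
      using assms(2) [of x r] x r by auto
    have "W \<subseteq> {x \<in> topspace Y. f x \<in> U}"
    proof
      fix y assume y: "y \<in> W"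
      then have "y \<in> topspace Y"
        using W(1) openin_subset by blast
      moreover have "f y \<in> mball (f x) r"
        using y W(3) assms(1) x \<open>y \<in> topspace Y\<close> by simp
      ultimately show "y \<in> {x \<in> topspace Y. f x \<in> U}"
        using r by blast
    qed
    then show "\<exists>T. openin Y T \<and> x \<in> T \<and> T \<subseteq> {x \<in> topspace Y. f x \<in> U}"
      using W by blast
  qed
qed

lemma continuous_map_linear:
  assumes "\<And>x. x \<in> M \<Longrightarrow> T x \<in> M"
    and "\<And>x y. x \<in> M \<Longrightarrow> y \<in> M \<Longrightarrow> T (x - y) = T x - T y"
    and "\<And>x. x \<in> M \<Longrightarrow> N (T x) \<le> C * N x" and "0 < C"
  shows "continuous_map mtopology mtopology T"
proof (rule continuous_map_into_mtopology)
  fix x e assume x: "x \<in> topspace mtopology" and e: "0 < (e::real)"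
  have "N (T x - T y) < e" if "y \<in> mball x (e / C)" for y
  proof -
    have "N (T x - T y) = N (T (x - y))" using assms(2) [of x y] that by simp
    also have "\<dots> \<le> C * N (x - y)" using assms(3) that by simp
    also have "\<dots> < e" using that \<open>0 < C\<close> by (simp add: field_simps)
    finally show ?thesis .
  qed
  then show "\<exists>W. openin mtopology W \<and> x \<in> W \<and> (\<forall>y\<in>W. N (T x - T y) < e)"
    using x e \<open>0 < C\<close> by (intro exI [of _ "mball x (e / C)"]) auto
qed (use assms(1) in simp)

lemma continuous_add:
  "continuous_map (prod_topology mtopology mtopology) mtopology (\<lambda>(x, y). x + y)"
proof (rule continuous_map_into_mtopology)
  fix z and e :: real
  assume "z \<in> topspace (prod_topology mtopology mtopology)" and e: "0 < e"
  then obtain x y where z: "z = (x, y)" "x \<in> M" "y \<in> M" by auto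
  have "N (x + y - (x' + y')) < e" if "x' \<in> mball x (e / 2)" "y' \<in> mball y (e / 2)" for x' y'
  proof -
    have "N (x + y - (x' + y')) = N ((x - x') + (y - y'))" by (simp add: algebra_simps)
    also have "\<dots> \<le> N (x - x') + N (y - y')" using that by (intro N_triangle) auto
    also have "\<dots> < e" using that by simp
    finally show ?thesis .
  qed
  then show "\<exists>W. openin (prod_topology mtopology mtopology) W \<and> z \<in> W \<and>
      (\<forall>w\<in>W. N ((case z of (x, y) \<Rightarrow> x + y) - (case w of (x, y) \<Rightarrow> x + y)) < e)"
    using z e by (intro exI [of _ "mball x (e / 2) \<times> mball y (e / 2)"])
      (auto simp: openin_prod_Times_iff)
qed auto

lemma continuous_scale:
  "continuous_map (prod_topology euclidean mtopology) mtopology (\<lambda>(c, x). scale c x)"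
proof (rule continuous_map_into_mtopology)
  fix z and e :: real
  assume "z \<in> topspace (prod_topology (euclidean :: 'k topology) mtopology)" and e: "0 < e"
  then obtain c x where z: "z = (c, x)" "x \<in> M" by auto
  \<comment> \<open>If both distances are below \<open>r \<le> 1\<close>, the images differ by less than \<open>r * (norm c + N x + 2)\<close>.\<close>
  define r where "r = min 1 (e / (norm c + N x + 2))"
  have pos: "norm c + N x + 2 > 0" using N_nonneg [of x] by (smt (verit) norm_ge_zero)
  have r: "0 < r" "r \<le> 1" "r * (norm c + N x + 2) \<le> e"
    using e pos pos_le_divide_eq [OF pos, of r e] by (auto simp: r_def)
  have "N (scale c x - scale c' x') < e" if "c' \<in> ball c r" "x' \<in> mball x r" for c' x'
  proof -
    have "norm c' \<le> norm c + norm (c' - c)" by (metis norm_triangle_sub)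
    then have c': "norm c' \<le> norm c + 1" "norm (c - c') < r"
      using that(1) r(2) by (auto simp: dist_norm norm_minus_commute)
    have "N (scale c x - scale c' x') = N (scale (c - c') x + scale c' (x - x'))"
      by (simp add: algebra_simps)
    also have "\<dots> \<le> N (scale (c - c') x) + N (scale c' (x - x'))"
      using that z by (intro N_triangle) auto
    also have "\<dots> = norm (c - c') * N x + norm c' * N (x - x')"
      using that z by (simp add: N_scale)
    also have "\<dots> \<le> r * N x + (norm c + 1) * r"
      using c' that r(1) by (intro add_mono mult_mono) (auto simp: N_nonneg)
    also have "\<dots> < r * (norm c + N x + 2)" using r(1) by (simp add: algebra_simps)
    finally show ?thesis using r(3) by simp
  qed
  then show "\<exists>W. openin (prod_topology euclidean mtopology) W \<and> z \<in> W \<and>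
      (\<forall>w\<in>W. N ((case z of (c, x) \<Rightarrow> scale c x) - (case w of (c, x) \<Rightarrow> scale c x)) < e)"
    using z r(1) by (intro exI [of _ "ball c r \<times> mball x r"])
      (auto simp: openin_prod_Times_iff)
qed auto

lemma mball_0_convex:
  assumes "x \<in> mball 0 r" "y \<in> mball 0 r" "t \<in> {0..1}"
  shows "scale (of_real (1 - t)) x + scale (of_real t) y \<in> mball 0 r"
proof -
  let ?z = "scale (of_real (1 - t)) x + scale (of_real t) y"
  have xy: "x \<in> M" "y \<in> M" "N x < r" "N y < r"
    using assms(1,2) by (auto simp: N_minus)
  have "N ?z \<le> N (scale (of_real (1 - t)) x) + N (scale (of_real t) y)"
    using xy by (intro N_triangle) auto
  also have "\<dots> = norm (of_real (1 - t) :: 'k) * N x + norm (of_real t :: 'k) * N y"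
    using xy by (simp only: N_scale)
  also have "\<dots> = (1 - t) * N x + t * N y"
    using assms(3) by (simp only: norm_of_real) auto
  also have "\<dots> < r" using assms(3) xy by (intro convex_bound_lt) auto
  finally show ?thesis using xy N_minus [of ?z] by simp
qed

lemma mcomplete_mtopology: "mcomplete"
  unfolding mcomplete_def
proof (intro allI impI)
  fix f assume f: "MCauchy f"
  have "\<exists>x\<in>M. (\<lambda>n. N (f n - x)) \<longlonglongrightarrow> 0"
  proof (rule N_complete)
    show "range f \<subseteq> M" using f by (simp add: MCauchy_def)
    show "\<exists>n0. \<forall>m\<ge>n0. \<forall>n\<ge>n0. N (f m - f n) < e" if "0 < e" for e
      using f that by (simp add: MCauchy_def)
  qed
  then obtain x where x: "x \<in> M" "(\<lambda>n. N (f n - x)) \<longlonglongrightarrow> 0" by blast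
  have "limitin mtopology f x sequentially"
    unfolding limit_metric_sequentially
  proof (intro conjI allI impI)
    fix e :: real assume "0 < e"
    then have "\<forall>\<^sub>F n in sequentially. N (f n - x) < e"
      using x(2) by (intro order_tendstoD)
    moreover have "f n \<in> M" for n using f by (auto simp: MCauchy_def)
    ultimately show "\<exists>n0. \<forall>n\<ge>n0. f n \<in> M \<and> N (f n - x) < e"
      by (simp add: eventually_sequentially)
  qed (rule x(1))
  then show "\<exists>x. limitin mtopology f x sequentially" ..
qed

theorem frechet_space_mtopology: "frechet_space scale mtopology"
proof unfold_locales
  show "\<exists>V. openin mtopology V \<and> 0 \<in> V \<and> V \<subseteq> U \<and>
      (\<forall>x\<in>V. \<forall>y\<in>V. \<forall>t\<in>{0..1}. scale (of_real (1 - t)) x + scale (of_real t) y \<in> V)"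
    if U: "openin mtopology U" "0 \<in> U" for U
  proof -
    obtain r where r: "r > 0" "mball 0 r \<subseteq> U"
      using U by (auto simp: openin_mtopology)
    then show ?thesis
      using mball_0_convex by (intro exI [of _ "mball 0 r"]) auto
  qed
  show "\<exists>d. Metric_space (topspace mtopology) d \<and>
      Metric_space.mtopology (topspace mtopology) d = mtopology \<and>
      Metric_space.mcomplete (topspace mtopology) d \<and>
      (\<forall>x\<in>topspace mtopology. \<forall>y\<in>topspace mtopology. \<forall>z\<in>topspace mtopology.
        d (x + z) (y + z) = d x y)"
    using mcomplete_mtopology Metric_space_axioms by (intro exI [of _ "\<lambda>x y. N (x - y)"]) simp
qed (use subspace_M continuous_add continuous_scale in auto)

end

section \<open>The exponents of the weights\<close>

definition window :: "nat \<Rightarrow> nat set" where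
  "window l = {2 ^ (2 ^ l + l) ..< 2 ^ 2 ^ Suc l}"

text \<open>
  A power of \<open>2\<close>, to fit with dyadic blocks, and growing fast enough for the slopes and blocks of
  length \<open>3 * p + 1 \<le> 4 ^ p\<close> at its multiples to have summable densities.
\<close>

definition spacing :: "nat \<Rightarrow> nat" where
  "spacing p = 16 ^ p"

text \<open>
  The \<open>2\<close>-adic valuation takes each value \<open>p\<close> on a set of window numbers with bounded gaps, and it
  never exceeds the window number.
\<close>

definition label :: "nat \<Rightarrow> nat" where
  "label l = multiplicity 2 l"

text \<open>
  The starting points of the copies. The window number \<open>l\<close> is determined by \<open>n\<close>, but as an argument
  it gives direct access to the label.
\<close>

definition marked :: "nat \<Rightarrow> nat \<Rightarrow> bool" where
  "marked l n \<longleftrightarrow> 1 \<le> l \<and> n \<in> window l \<and> spacing (label l) dvd n"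

text \<open>
  \<open>high h n\<close> says that the construction asks for an exponent of at least \<open>h\<close> at \<open>n\<close>. The first
  alternative surrounds the \<open>l\<close>-th window by an interval with room for the differences between its
  points and those of earlier windows; the second one is for the differences inside a window.
\<close>

definition high :: "nat \<Rightarrow> nat \<Rightarrow> bool" where
  "high h n \<longleftrightarrow>
    (\<exists>l\<ge>1. h \<le> 2 * l \<and> 2 ^ (2 ^ l + l - 1) \<le> n \<and> n \<le> 2 ^ Suc (2 ^ Suc l)) \<or>
    (\<exists>p i. h \<le> 2 * p \<and> 1 \<le> i \<and> spacing p * i \<le> n \<and> n \<le> spacing p * i + p)"

text \<open>
  The least function that meets these requests and grows by at most \<open>1\<close> from each number to the
  next: a request \<open>j\<close> places ahead counts with \<open>j\<close> subtracted. The maximum is over a finite set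
  because a request at \<open>n\<close> never exceeds \<open>n\<close>.
\<close>

definition height :: "nat \<Rightarrow> nat" where
  "height n = Max {h. h = 0 \<or> (\<exists>j. high (h + j) (n + j))}"

lemma Suc_le_power2: "Suc n \<le> 2 ^ n"
  using less_exp [of n] by (rule Suc_leI)

lemma spacing_ge: "1 \<le> spacing p" "2 * p \<le> spacing p" "(3 * p + 1) * 4 ^ p \<le> spacing p" "1 \<le> p \<Longrightarrow> 4 * p \<le> spacing p"
proof -
  have 1: "3 * p + 1 \<le> 4 ^ p" by (induction p) auto
  then have "(3 * p + 1) * 4 ^ p \<le> 4 ^ p * 4 ^ p" by (rule mult_le_mono1)
  then show 2: "(3 * p + 1) * 4 ^ p \<le> spacing p" by (simp add: spacing_def flip: power_mult_distrib)
  show "1 \<le> spacing p" by (simp add: spacing_def)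
  have 3: "(3 * p + 1) * 1 \<le> (3 * p + 1) * 4 ^ p" by (rule mult_le_mono2) simp
  then show "2 * p \<le> spacing p" using order_trans [OF 3 2] by simp
  assume "1 \<le> p"
  then have "(4::nat) ^ 1 \<le> 4 ^ p" by (intro power_increasing) auto
  then have "(3 * p + 1) * 4 \<le> (3 * p + 1) * 4 ^ p" by (intro mult_le_mono2) simp
  from order_trans [OF this 2] show "4 * p \<le> spacing p" by simp
qed

lemma high_le: "high h n \<Longrightarrow> h \<le> n"
  unfolding high_def
proof (elim disjE exE conjE)
  fix l :: nat assume l: "1 \<le> l" "h \<le> 2 * l" "2 ^ (2 ^ l + l - 1) \<le> n"
  have "2 * l \<le> 2 ^ l + l - 1" using Suc_le_power2 [of l] by linarith
  also have "\<dots> \<le> 2 ^ (2 ^ l + l - 1)" using less_exp [of "2 ^ l + l - 1"] by linarith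
  finally show "h \<le> n" using l by linarith
next
  fix p i :: nat assume p: "h \<le> 2 * p" "1 \<le> i" "spacing p * i \<le> n"
  have "spacing p * 1 \<le> spacing p * i" using p by (intro mult_le_mono2) simp
  then show "h \<le> n" using p spacing_ge(2) [of p] by linarith
qed

lemma finite_heights: "finite {h. h = 0 \<or> (\<exists>j. high (h + j) (n + j))}"
  by (rule finite_subset [of _ "{..n}"]) (auto dest: high_le)

lemma high_mono: "high h n \<Longrightarrow> h' \<le> h \<Longrightarrow> high h' n"
  unfolding high_def by (meson le_trans)

lemma le_height: "high (h + j) (n + j) \<Longrightarrow> h \<le> height n"
  unfolding height_def by (rule Max_ge [OF finite_heights]) auto

lemma high_of_height:
  assumes "h \<le> height n" "0 < h"
  obtains j where "high (h + j) (n + j)"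
proof -
  have "height n \<in> {h. h = 0 \<or> (\<exists>j. high (h + j) (n + j))}"
    unfolding height_def using finite_heights by (rule Max_in) auto
  then obtain j where "high (height n + j) (n + j)" using assms by auto
  then show thesis using assms that high_mono by (meson add_le_mono1)
qed

lemma height_Suc_le: "height (Suc n) \<le> Suc (height n)"
proof (cases "height (Suc n)")
  case (Suc h)
  then obtain j where "high (Suc h + j) (Suc n + j)"
    using high_of_height [of "Suc h" "Suc n"] by auto
  then show ?thesis using Suc le_height [of h "Suc j" n] by simp
qed simp

lemma label_le: "1 \<le> l \<Longrightarrow> label l \<le> l"
proof -
  assume l: "1 \<le> l"
  have "2 ^ label l dvd l" unfolding label_def by (rule multiplicity_dvd)
  then have "2 ^ label l \<le> l" using l dvd_imp_le by auto
  then show ?thesis using less_exp [of "label l"] by linarith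
qed

lemma label_power2_mult_odd: "label (2 ^ p * (2 * i + 1)) = p"
proof -
  have "multiplicity 2 (2 ^ p * (2 * i + 1)) = p" 
  proof (rule multiplicity_eqI)
    have "\<not> 2 ^ p * 2 dvd 2 ^ p * (2 * i + 1)"
      by (simp only: nat_mult_dvd_cancel_disj) simp
    then show "\<not> 2 ^ Suc p dvd 2 ^ p * (2 * i + 1)" by (simp only: power_Suc2 not_False_eq_True)
  qed simp
  then show ?thesis by (simp add: label_def)
qed

text \<open>
  The earlier window ends at \<open>2 ^ 2 ^ l'\<close> at the latest, and the later one starts at \<open>2 ^ l'\<close> times
  that number.
\<close>

lemma window_separation:
  assumes "1 \<le> l'" "n \<in> window l" "n' \<in> window l'" "l < l'"
  shows "2 ^ 2 ^ l' * (2 ^ l' - 1) + n \<le> n'"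
proof -
  have "(2::nat) ^ 2 ^ Suc l \<le> 2 ^ 2 ^ l'"
    using assms(4) by (intro power_increasing) auto
  moreover have "n < 2 ^ 2 ^ Suc l" using assms(2) by (simp add: window_def del: power_Suc)
  ultimately have *: "n \<le> 2 ^ 2 ^ l'" by linarith
  have "(2::nat) ^ (2 ^ l' + l') = 2 ^ 2 ^ l' * (2 ^ l' - 1) + 2 ^ 2 ^ l'"
    by (simp add: power_add algebra_simps)
  then show "2 ^ 2 ^ l' * (2 ^ l' - 1) + n \<le> n'" using assms(3) * by (auto simp: window_def)
qed

text \<open>
  This is what the definition of \<open>high\<close> is made for. In one window, both points are multiples of the
  same \<open>spacing\<close>. For different windows, the difference is at least half of the start of the later one
  and at most its end, and both labels are bounded by the later window number.
\<close>

lemma high_diff: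
  assumes "marked l n" "marked l' n'" "n < n'" "t \<le> label l'"
  shows "high (label l + label l') (n' - n + t)"
proof -
  have l: "1 \<le> l" "1 \<le> l'" "n \<in> window l" "n' \<in> window l'" 
      "spacing (label l) dvd n" "spacing (label l') dvd n'"
    using assms(1,2) by (auto simp: marked_def)
  consider "l = l'" | "l < l'" | "l' < l" by linarith
  then show ?thesis
  proof cases
    case 1
    then have "spacing (label l') dvd n' - n" using l by (simp add: dvd_diff_nat)
    then obtain i where i: "n' - n = spacing (label l') * i" by (auto simp: dvd_def)
    then have "1 \<le> i" using assms(3) by (cases i) auto
    then show ?thesis unfolding high_def using i 1 assms(4)
      by (intro disjI2 exI [of _ "label l'"] exI [of _ i]) auto
  next
    case 2
    have e: "(2::nat) ^ (2 ^ l' + l' - 1) = 2 ^ 2 ^ l' * 2 ^ (l' - 1)"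
      using l(2) by (simp flip: power_add)
    have "2 ^ (l' - 1) \<le> 2 ^ l' - (1::nat)" using l(2) by (cases l') (auto simp: Suc_le_power2)
    then have "(2::nat) ^ 2 ^ l' * 2 ^ (l' - 1) \<le> 2 ^ 2 ^ l' * (2 ^ l' - 1)"
      by (rule mult_le_mono2)
    with e have "2 ^ (2 ^ l' + l' - 1) \<le> n' - n + t"
      using window_separation [OF l(2,3,4) 2] by linarith
    moreover have "n' - n + t \<le> 2 ^ Suc (2 ^ Suc l')"
    proof -
      have "l' \<le> 2 ^ 2 ^ Suc l'"
        using less_exp [of "Suc l'"] less_exp [of "2 ^ Suc l'"] by linarith
      moreover have "n' < 2 ^ 2 ^ Suc l'" using l(4) by (simp add: window_def del: power_Suc)
      moreover have "(2::nat) ^ Suc (2 ^ Suc l') = 2 * 2 ^ 2 ^ Suc l'" by (rule power_Suc)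
      ultimately show ?thesis using assms(4) label_le [OF l(2)] by linarith
    qed
    moreover have "label l + label l' \<le> 2 * l'"
      using label_le [OF l(1)] label_le [OF l(2)] 2 by linarith
    ultimately show ?thesis unfolding high_def using l(2) by blast
  next
    case 3
    then show ?thesis using window_separation [OF l(1,4,3) 3] assms(3) by linarith
  qed
qed

lemma high_marked:
  assumes "marked l n" "t \<le> label l"
  shows "high (2 * l) (n + t)"
proof -
  have l: "1 \<le> l" "n \<in> window l" using assms(1) by (auto simp: marked_def)
  have "l \<le> 2 ^ 2 ^ Suc l"
    using less_exp [of "Suc l"] less_exp [of "2 ^ Suc l"] by linarith
  moreover have "n < 2 ^ 2 ^ Suc l" using l(2) by (simp add: window_def del: power_Suc)
  moreover have "(2::nat) ^ Suc (2 ^ Suc l) = 2 * 2 ^ 2 ^ Suc l" by (rule power_Suc)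
  ultimately have "n + t \<le> 2 ^ Suc (2 ^ Suc l)"
    using assms(2) label_le [OF l(1)] by linarith
  moreover have "(2::nat) ^ (2 ^ l + l - 1) \<le> 2 ^ (2 ^ l + l)" by (intro power_increasing) auto
  moreover have "2 ^ (2 ^ l + l) \<le> n" using l(2) by (simp add: window_def)
  ultimately have "2 ^ (2 ^ l + l - 1) \<le> n + t" by linarith
  with \<open>n + t \<le> 2 ^ Suc (2 ^ Suc l)\<close> show ?thesis unfolding high_def using l(1) by blast
qed

text \<open>
  Copies of length \<open>label l + 1\<close> that start at marked points do not overlap: in one window the marked
  points are \<open>spacing (label l)\<close> apart, and different windows are separated by much more than their
  numbers.
\<close>

lemma marked_blocks_disjoint:
  assumes "marked l n" "marked l' n'" "n < n'"
  shows "n + label l < n'"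
proof -
  have l: "1 \<le> l" "1 \<le> l'" "n \<in> window l" "n' \<in> window l'" 
      "spacing (label l) dvd n" "spacing (label l') dvd n'"
    using assms(1,2) by (auto simp: marked_def)
  consider "l = l'" | "l < l'" | "l' < l" by linarith
  then show ?thesis
  proof cases
    case 1
    then have "spacing (label l) dvd n' - n" using l by (simp add: dvd_diff_nat)
    then have "spacing (label l) \<le> n' - n" using assms(3) by (intro dvd_imp_le) auto
    moreover have "label l < spacing (label l)" unfolding spacing_def
      by (rule less_le_trans [OF less_exp]) (intro power_mono, auto)
    ultimately show ?thesis using assms(3) by linarith
  next
    case 2
    have "label l < l'" using label_le [OF l(1)] 2 by simp
    also have "l' \<le> 2 ^ 2 ^ l'" using less_exp [of l'] less_exp [of "2 ^ l'"] by linarith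
    also have "(2::nat) ^ 2 ^ l' * 1 \<le> 2 ^ 2 ^ l' * (2 ^ l' - 1)"
      using Suc_le_power2 [of l'] l(2) by (intro mult_le_mono2) linarith
    finally show ?thesis using window_separation [OF l(2,3,4) 2] by linarith
  next
    case 3
    then show ?thesis using window_separation [OF l(1,4,3) 3] assms(3) by linarith
  qed
qed

lemma window_unique:
  assumes "1 \<le> l" "1 \<le> l'" "n \<in> window l" "n \<in> window l'"
  shows "l = l'"
proof (rule ccontr)
  have *: False if "1 \<le> b" "n \<in> window a" "n \<in> window b" "a < b" for a b
  proof -
    have "(2::nat) ^ 2 ^ b * (2 ^ b - 1) > 0" using Suc_le_power2 [of b] that(1) by simp
    then show ?thesis using window_separation [OF that] by linarith
  qed
  assume "l \<noteq> l'"
  then show False using * assms by (meson nat_neq_iff)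
qed

lemma marked_block_unique:
  assumes "marked l n" "marked l' n'" "n \<le> k" "k \<le> n + label l" "n' \<le> k" "k \<le> n' + label l'"
  shows "l = l' \<and> n = n'"
proof -
  have "n = n'"
    using marked_blocks_disjoint [OF assms(1,2)] marked_blocks_disjoint [OF assms(2,1)] assms(3-)
    by linarith
  then show ?thesis using window_unique [of l l' n] assms(1,2) by (auto simp: marked_def)
qed

section \<open>Lower density of the places of large height\<close>

lemma height_geE:
  assumes "2 * s \<le> height n" "0 < s"
  obtains l where "1 \<le> l" "2 ^ (2 ^ l + l - 1) \<le> n + 2 * l" "n \<le> 2 ^ Suc (2 ^ Suc l)"
  | p i where "s \<le> p" "1 \<le> i" "spacing p * i \<le> n + 2 * p" "n \<le> spacing p * i + p"
proof -
  obtain j where "high (2 * s + j) (n + j)"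
    using high_of_height [OF assms(1)] assms(2) by auto
  then show thesis
    unfolding high_def
  proof (elim disjE exE conjE)
    fix l :: nat
    assume "1 \<le> l" "2 * s + j \<le> 2 * l" "2 ^ (2 ^ l + l - 1) \<le> n + j"
      "n + j \<le> 2 ^ Suc (2 ^ Suc l)"
    then show thesis by (intro that(1) [of l]) linarith+
  next
    fix p i :: nat
    assume "2 * s + j \<le> 2 * p" "1 \<le> i" "spacing p * i \<le> n + j" "n + j \<le> spacing p * i + p"
    then show thesis by (intro that(2) [of p i]) linarith+
  qed
qed

text \<open>
  The number \<open>2 ^ (2 ^ l + l - 2)\<close> lies late in the gap in front of the \<open>l\<close>-th window, but before
  all places where \<open>height\<close> is positive on account of this window or a later one.
\<close>

lemma window_surroundings_beyond_gap:
  assumes "2 \<le> l" "l \<le> l'"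
  shows "2 ^ (2 ^ l + l - 2) + 2 * l' < (2::nat) ^ (2 ^ l' + l' - 1)"
proof -
  have "2 ^ l \<le> (2::nat) ^ l'" using assms(2) by (intro power_increasing) auto
  then have "(2::nat) ^ (2 ^ l + l - 2) \<le> 2 ^ (2 ^ l' + l' - 2)"
    using assms(2) by (intro power_increasing diff_le_mono add_mono) auto
  moreover have "2 * l' < 2 ^ (2 ^ l' + l' - 2)"
  proof -
    have 1: "Suc l' \<le> 2 ^ l'" by (rule Suc_le_power2)
    have "2 * l' \<le> 2 ^ l' + l' - 1" using 1 by linarith
    also have "2 ^ l' + l' - 1 = Suc (2 ^ l' + l' - 2)" using assms by simp
    also have "\<dots> \<le> 2 ^ (2 ^ l' + l' - 2)" by (rule Suc_le_power2)
    finally have "2 * l' \<le> 2 ^ (2 ^ l' + l' - 2)" .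
    moreover have "2 * l' \<noteq> 2 ^ (2 ^ l' + l' - 2)"
    proof
      assume e: "2 * l' = 2 ^ (2 ^ l' + l' - 2)"
      have "2 ^ l' + l' - 2 = Suc (2 ^ l' + l' - 3)" using assms 1 by simp
      then have "l' = 2 ^ (2 ^ l' + l' - 3)" using e by simp
      moreover have "l' \<le> 2 ^ l' + l' - 3" using 1 assms by linarith
      ultimately show False using less_exp [of "2 ^ l' + l' - 3"] by linarith
    qed
    ultimately show ?thesis by linarith
  qed
  moreover have "2 ^ l' + l' - 1 = Suc (2 ^ l' + l' - 2)" using assms by simp
  ultimately show ?thesis by (simp only: power_Suc)
qed

text \<open>
  The first part absorbs all windows before the gap. In the second part, \<open>2 * p\<close> is the range of the
  slope that leads up to a request of height \<open>2 * p\<close>. As this is at most half of \<open>spacing p\<close>, only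
  multiples of \<open>spacing p\<close> up to \<open>2 * N\<close> have to be considered.
\<close>

lemma high_times_subset:
  assumes "2 \<le> l" "0 < s" and N: "N = 2 ^ (2 ^ l + l - 2)"
  shows "{n \<in> {1..N}. 2 * s \<le> height n} \<subseteq>
    {..2 ^ Suc (2 ^ l)} \<union>
      (\<Union>p\<in>{s..2 * N}. \<Union>i\<in>{1..2 * N div spacing p}. {spacing p * i - 2 * p..spacing p * i + p})"
    (is "_ \<subseteq> ?A \<union> ?B")
proof
  fix n assume "n \<in> {n \<in> {1..N}. 2 * s \<le> height n}"
  then have n: "1 \<le> n" "n \<le> N" "2 * s \<le> height n" by auto
  from n(3) assms(2) show "n \<in> ?A \<union> ?B"
  proof (cases rule: height_geE)
    case (1 l')
    have "\<not> l \<le> l'" using window_surroundings_beyond_gap [OF assms(1), of l'] 1 n(2) N by linarith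
    then have "(2::nat) ^ Suc l' \<le> 2 ^ l" by (intro power_increasing) auto
    then have "(2::nat) ^ Suc (2 ^ Suc l') \<le> 2 ^ Suc (2 ^ l)" by (intro power_increasing) auto
    with 1(3) have "n \<le> 2 ^ Suc (2 ^ l)" by (rule order_trans)
    then show ?thesis by (simp del: power_Suc)
  next
    case (2 p i)
    have "4 * p \<le> spacing p" using spacing_ge(4) 2(1) assms(2) by simp
    also have "spacing p * 1 \<le> spacing p * i" using 2 by (intro mult_le_mono2) simp
    finally have i: "spacing p * i \<le> 2 * N" using 2 n(2) by linarith
    have "i \<le> 2 * N div spacing p"
      using i spacing_ge(1) [of p] by (simp add: less_eq_div_iff_mult_less_eq mult.commute)
    moreover have "p \<le> 2 * N"
      using i \<open>4 * p \<le> spacing p\<close> \<open>spacing p * 1 \<le> spacing p * i\<close> by linarith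
    ultimately show ?thesis using 2 by auto
  qed
qed

lemma sum_inverse_power4: "(\<Sum>p=s..M. 1 / 4 ^ p) \<le> (4 / 3) / (4::real) ^ s"
proof (cases "s \<le> M")
  case True
  have "(\<Sum>p=s..s+k. 1 / 4 ^ p) = (4/3) / (4::real) ^ s - (1/3) / 4 ^ (s + k)" for k
  proof (induction k)
    case (Suc k)
    have "(\<Sum>p=s..s + Suc k. 1 / (4::real) ^ p) = (\<Sum>p=s..s+k. 1 / 4 ^ p) + 1 / 4 ^ Suc (s + k)"
      by simp
    then show ?case using Suc.IH by simp
  qed simp
  from this [of "M - s"] True show ?thesis by simp
qed auto

text \<open>
  Each multiple of \<open>spacing p = 16 ^ p\<close> accounts for \<open>3 * p + 1 \<le> 4 ^ p\<close> numbers, and there are at most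
  \<open>2 * N / 16 ^ p\<close> multiples; what remains is a geometric series with ratio \<open>1 / 4\<close>.
\<close>

lemma card_high_times:
  fixes N :: nat
  assumes "2 \<le> l" "0 < s" and N: "N = 2 ^ (2 ^ l + l - 2)"
  shows "real (card {n \<in> {1..N}. 2 * s \<le> height n}) \<le> 1 + 2 ^ Suc (2 ^ l) + 3 * N / 4 ^ s"
proof -
  let ?I = "\<lambda>p i. {spacing p * i - 2 * p..spacing p * i + p}"
  let ?B = "\<Union>p\<in>{s..2 * N}. \<Union>i\<in>{1..2 * N div spacing p}. ?I p i"
  have "card {n \<in> {1..N}. 2 * s \<le> height n} \<le> card ({..2 ^ Suc (2 ^ l)} \<union> ?B)"
    by (intro card_mono high_times_subset assms) auto
  also have "\<dots> \<le> card {..(2::nat) ^ Suc (2 ^ l)} + card ?B" by (rule card_Un_le)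
  also have "card ?B \<le> (\<Sum>p\<in>{s..2 * N}. card (\<Union>i\<in>{1..2 * N div spacing p}. ?I p i))"
    by (rule card_UN_le) simp
  also have "\<dots> \<le> (\<Sum>p\<in>{s..2 * N}. (3 * p + 1) * (2 * N div spacing p))"
  proof (rule sum_mono)
    fix p
    have "card (\<Union>i\<in>{1..2 * N div spacing p}. ?I p i) \<le> (\<Sum>i\<in>{1..2 * N div spacing p}. card (?I p i))"
      by (rule card_UN_le) simp
    also have "\<dots> \<le> (\<Sum>i\<in>{1..2 * N div spacing p}. 3 * p + 1)"
      by (intro sum_mono) simp
    also have "\<dots> = (3 * p + 1) * (2 * N div spacing p)" by simp
    finally show "card (\<Union>i\<in>{1..2 * N div spacing p}. ?I p i) \<le> (3 * p + 1) * (2 * N div spacing p)" .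
  qed
  finally have "real (card {n \<in> {1..N}. 2 * s \<le> height n}) \<le>
      real (card {..(2::nat) ^ Suc (2 ^ l)} + (\<Sum>p\<in>{s..2 * N}. (3 * p + 1) * (2 * N div spacing p)))"
    by (simp only: of_nat_le_iff)
  also have "\<dots> = 1 + 2 ^ Suc (2 ^ l) + (\<Sum>p\<in>{s..2 * N}. real ((3 * p + 1) * (2 * N div spacing p)))"
    by simp
  also have "(\<Sum>p\<in>{s..2 * N}. real ((3 * p + 1) * (2 * N div spacing p))) \<le>
      (\<Sum>p=s..2 * N. 2 * N * (1 / 4 ^ p))"
  proof (rule sum_mono)
    fix p
    have "(3 * p + 1) * (2 * N div spacing p) * 4 ^ p = (3 * p + 1) * 4 ^ p * (2 * N div spacing p)"
      by (simp add: algebra_simps)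
    also have "\<dots> \<le> spacing p * (2 * N div spacing p)" using spacing_ge(3) [of p] by (rule mult_le_mono1)
    also have "\<dots> \<le> 2 * N" by simp
    finally have "real ((3 * p + 1) * (2 * N div spacing p) * 4 ^ p) \<le> real (2 * N)"
      by (simp only: of_nat_le_iff)
    then show "real ((3 * p + 1) * (2 * N div spacing p)) \<le> 2 * N * (1 / 4 ^ p)"
      by (simp add: field_simps)
  qed
  also have "\<dots> = 2 * N * (\<Sum>p=s..2 * N. 1 / 4 ^ p)" by (simp add: sum_distrib_left)
  also have "\<dots> \<le> 2 * N * ((4 / 3) / 4 ^ s)"
    by (intro mult_left_mono sum_inverse_power4) simp
  also have "\<dots> \<le> 3 * N / 4 ^ s" by (simp add: field_simps)
  finally show ?thesis by simp
qed

text \<open>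
  Up to a finite part, such a set is contained in each of the sets \<open>{n. 2 * s \<le> height n}\<close>. Near
  the end of a far away gap, the finite part and the earlier windows are negligible, and the bound \<open>3 / 4 ^ s\<close>
  for the rest is as small as desired.
\<close>

lemma lower_density_le_0_if_height_to_infinity:
  assumes "\<And>h. finite {n \<in> E. height n < h}"
  shows "lower_density E \<le> 0"
proof (rule ccontr)
  assume "\<not> lower_density E \<le> 0"
  then have "0 < lower_density E" by simp
  then obtain c where c: "0 < ereal c" "ereal c < lower_density E"
    by (metis ereal_dense2)
  then have c0: "0 < c" by simp
  from c(2) have "\<forall>\<^sub>F n in sequentially. ereal c < ereal (real (card (E \<inter> {1..n})) / real n)"
    unfolding lower_density_def by (rule less_LiminfD)
  then obtain n0 where n0: "\<And>n. n \<ge> n0 \<Longrightarrow> c < real (card (E \<inter> {1..n})) / real n"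
    by (auto simp: eventually_sequentially)
  \<comment> \<open>The count near the end of the gap has three parts, each of which is kept below \<open>c / 4 * N\<close>.\<close>
  obtain s :: nat where s: "3 / c < 4 ^ s" using real_arch_pow [of 4 "3 / c * 2"] c0
    by (metis one_less_numeral_iff semiring_norm(76) real_arch_pow)
  define s' where "s' = Suc s"
  have s': "0 < s'" "3 / 4 ^ s' < c / 4" using s c0 by (auto simp: s'_def field_simps)
  define K where "K = card {n \<in> E. height n < 2 * s'}"
  obtain l where l: "2 \<le> l" "n0 \<le> l" "(K + 1) / c * 4 \<le> real l" "32 / c \<le> 2 ^ l"
  proof -
    obtain l1 where l1: "32 / c < 2 ^ l1" using real_arch_pow [of 2 "32 / c"] by auto
    obtain l2 where l2: "(K + 1) / c * 4 \<le> real l2" using real_arch_simple by blast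
    have "(2::real) ^ l1 \<le> 2 ^ (2 + n0 + l1 + l2)" by (intro power_increasing) auto
    with l1 l2 show thesis by (intro that [of "2 + n0 + l1 + l2"]) auto
  qed
  define N :: nat where "N = 2 ^ (2 ^ l + l - 2)"
  have Nl: "l \<le> N"
  proof -
    have "l \<le> 2 ^ l + l - 2" using l(1) Suc_le_power2 [of l] by linarith
    then show ?thesis unfolding N_def using less_exp [of "2 ^ l + l - 2"] by linarith
  qed
  have "card (E \<inter> {1..N}) \<le> card ({n \<in> E. height n < 2 * s'} \<union> {n \<in> {1..N}. 2 * s' \<le> height n})"
    using assms by (intro card_mono) auto
  also have "\<dots> \<le> K + card {n \<in> {1..N}. 2 * s' \<le> height n}"
    unfolding K_def by (rule card_Un_le)
  finally have "real (card (E \<inter> {1..N})) \<le> K + (1 + 2 ^ Suc (2 ^ l) + 3 * N / 4 ^ s')"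
    using card_high_times [OF l(1) s'(1) N_def] by linarith
  moreover have "3 * N / 4 ^ s' \<le> c / 4 * N"
    using mult_right_mono [OF less_imp_le [OF s'(2)], of "real N"] by simp
  moreover have "K + 1 \<le> c / 4 * N"
  proof -
    have "(K + 1) / c * 4 \<le> N" using l(3) Nl by linarith
    then show ?thesis using c0 by (simp add: field_simps)
  qed
  moreover have "2 ^ Suc (2 ^ l) \<le> c / 4 * N"
  proof -
    have "2 ^ l + l = Suc (Suc (2 ^ l + l - 2))" using l(1) by simp
    then have "(2::real) ^ (2 ^ l + l) = 2 ^ Suc (Suc (2 ^ l + l - 2))" by (rule arg_cong)
    also have "\<dots> = 4 * N" by (simp add: N_def)
    finally have "(2::real) ^ (2 ^ l + l) = 4 * N" .
    then have "4 * real N = 2 ^ 2 ^ l * 2 ^ l" by (simp add: power_add)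
    moreover have "(32 / c) * 2 ^ 2 ^ l \<le> 2 ^ l * (2::real) ^ 2 ^ l"
      using l(4) by (intro mult_right_mono) auto
    ultimately have "32 * 2 ^ 2 ^ l \<le> c * (4 * real N)" using c0 by (simp add: field_simps)
    then show ?thesis by simp
  qed
  ultimately have "real (card (E \<inter> {1..N})) \<le> c * N" by linarith
  moreover have "c < real (card (E \<inter> {1..N})) / N" "0 < real N" using n0 [of N] Nl l by auto
  ultimately show False by (simp add: field_simps)
qed

section \<open>Lower logarithmic density of the marked points\<close>

lemma harmonic_sum_le: "(\<Sum>j\<in>{1..<2 ^ m}. 1 / real j) \<le> real m"
proof (induction m)
  case (Suc m)
  have "{1..<2 ^ Suc m} = {1..<2 ^ m} \<union> {2 ^ m..<(2::nat) ^ Suc m}" by auto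
  then have "(\<Sum>j\<in>{1..<2 ^ Suc m}. 1 / real j) =
      (\<Sum>j\<in>{1..<2 ^ m}. 1 / real j) + (\<Sum>j\<in>{2 ^ m..<2 ^ Suc m}. 1 / real j)"
    by (simp only:) (intro sum.union_disjoint, auto)
  also have "(\<Sum>j\<in>{2 ^ m..<(2::nat) ^ Suc m}. 1 / real j) \<le> (\<Sum>j\<in>{2 ^ m..<(2::nat) ^ Suc m}. 1 / 2 ^ m)"
    by (intro sum_mono divide_left_mono) (auto simp flip: of_nat_le_iff)
  also have "\<dots> = 1" by simp
  finally show ?case using Suc by simp
qed simp

text \<open>
  A dyadic block contains \<open>2 ^ (i - c)\<close> multiples of \<open>2 ^ c\<close>, each with reciprocal at least
  \<open>1 / 2 ^ (i + 1)\<close>. Since a whole block has logarithmic mass at most \<open>1\<close>, counting blocks replaces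
  logarithms in what follows.
\<close>

lemma dyadic_sum_multiples_ge:
  assumes "c \<le> i"
  shows "1 / 2 ^ Suc c \<le> (\<Sum>n | n \<in> {2 ^ i..<2 ^ Suc i} \<and> 2 ^ c dvd n. 1 / real n)"
proof -
  let ?K = "{2 ^ (i - c)..<2 ^ Suc (i - c)} :: nat set"
  let ?S = "{n. n \<in> {2 ^ i..<2 ^ Suc i} \<and> 2 ^ c dvd (n::nat)}"
  have e: "(2::nat) ^ i = 2 ^ c * 2 ^ (i - c)" using assms by (simp flip: power_add)
  have sub: "(\<lambda>k. 2 ^ c * k) ` ?K \<subseteq> ?S" using e by auto
  have "inj_on (\<lambda>k::nat. 2 ^ c * k) ?K" by (auto intro: inj_onI)
  then have "2 ^ (i - c) = card ((\<lambda>k. 2 ^ c * k) ` ?K)" by (simp add: card_image)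
  also have "\<dots> \<le> card ?S" using sub by (intro card_mono) auto
  finally have card: "(2::real) ^ (i - c) \<le> card ?S" by (metis of_nat_le_iff of_nat_numeral of_nat_power)
  have "(2::real) ^ i = 2 ^ c * 2 ^ (i - c)" using assms by (simp flip: power_add)
  then have "1 / 2 ^ Suc c = 2 ^ (i - c) * (1 / (2::real) ^ Suc i)" by simp
  also have "\<dots> \<le> card ?S * (1 / 2 ^ Suc i)" using card by (intro mult_right_mono) auto
  also have "\<dots> = (\<Sum>n\<in>?S. 1 / 2 ^ Suc i)" by simp
  also have "\<dots> \<le> (\<Sum>n\<in>?S. 1 / real n)"
  proof (intro sum_mono divide_left_mono)
    fix n assume n: "n \<in> ?S"
    then have "real n \<le> real (2 ^ Suc i)" by (intro of_nat_mono) auto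
    then show "real n \<le> 2 ^ Suc i" by simp
    have "0 < n" using n by (auto intro: less_le_trans [of 0 "2 ^ i"])
    then show "0 < 2 ^ Suc i * real n" by simp
  qed auto
  finally show ?thesis .
qed

lemma sum_multiples_ge:
  assumes "c \<le> a"
  shows "real k / 2 ^ Suc c \<le> (\<Sum>n | n \<in> {2 ^ a..<2 ^ (a + k)} \<and> 2 ^ c dvd n. 1 / real n)"
proof (induction k)
  case (Suc k)
  have "(2::nat) ^ a \<le> 2 ^ (a + k)" "(2::nat) ^ (a + k) \<le> 2 ^ Suc (a + k)"
    by (intro power_increasing; simp)+
  then have "{2 ^ a..<2 ^ (a + Suc k)} =
      {2 ^ a..<2 ^ (a + k)} \<union> {2 ^ (a + k)..<(2::nat) ^ Suc (a + k)}"
    unfolding add_Suc_right by (simp only: ivl_disj_un)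
  then have set: "{n. n \<in> {2 ^ a..<2 ^ (a + Suc k)} \<and> 2 ^ c dvd (n::nat)} =
      {n. n \<in> {2 ^ a..<2 ^ (a + k)} \<and> 2 ^ c dvd n} \<union>
      {n. n \<in> {2 ^ (a + k)..<2 ^ Suc (a + k)} \<and> 2 ^ c dvd n}"
    by (simp only:) blast
  have "(\<Sum>n | n \<in> {2 ^ a..<2 ^ (a + Suc k)} \<and> 2 ^ c dvd n. 1 / real n) =
      (\<Sum>n | n \<in> {2 ^ a..<2 ^ (a + k)} \<and> 2 ^ c dvd n. 1 / real n) +
      (\<Sum>n | n \<in> {2 ^ (a + k)..<2 ^ Suc (a + k)} \<and> 2 ^ c dvd n. 1 / real n)"
    unfolding set by (rule sum.union_disjoint) (auto simp del: power_Suc)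
  moreover have "1 / 2 ^ Suc c \<le>
      (\<Sum>n | n \<in> {2 ^ (a + k)..<2 ^ Suc (a + k)} \<and> 2 ^ c dvd n. 1 / real n)"
    using assms by (intro dyadic_sum_multiples_ge) simp
  moreover have "real (Suc k) / 2 ^ Suc c = real k / 2 ^ Suc c + 1 / 2 ^ Suc c"
    by (simp add: add_divide_distrib)
  ultimately show ?case using Suc.IH by linarith
qed simp

text \<open>
  The \<open>l\<close>-th window consists of \<open>2 ^ l - l\<close> dyadic blocks, at least half of \<open>2 ^ l\<close>.
\<close>

lemma sum_marked_ge:
  assumes "1 \<le> l" "4 * label l \<le> 2 ^ l"
  shows "2 ^ l / (4 * real (spacing (label l))) \<le> (\<Sum>n | marked l n. 1 / real n)"
proof -
  define c where "c = 4 * label l"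
  have spacing: "spacing (label l) = 2 ^ c" by (simp add: spacing_def c_def power_mult)
  have "l + l \<le> 2 ^ l"
    using assms(1) Suc_le_power2 [of "l - 1"] by (cases l) auto
  then have "2 * l \<le> 2 ^ l" by simp
  have w: "window l = {2 ^ (2 ^ l + l)..<2 ^ (2 ^ l + l + (2 ^ l - l))}"
    using \<open>2 * l \<le> 2 ^ l\<close> by (simp add: window_def mult_2)
  have "2 ^ l / (4 * real (spacing (label l))) = (2 ^ l / 2) / 2 ^ Suc c" by (simp add: spacing)
  also have "\<dots> \<le> real (2 ^ l - l) / 2 ^ Suc c"
  proof (rule divide_right_mono)
    have "real (2 * l) \<le> real (2 ^ l)" using \<open>2 * l \<le> 2 ^ l\<close> by (simp only: of_nat_le_iff)
    then show "2 ^ l / 2 \<le> real (2 ^ l - l)" using \<open>2 * l \<le> 2 ^ l\<close> by (simp add: of_nat_diff)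
  qed simp
  also have "\<dots> \<le> (\<Sum>n | n \<in> window l \<and> 2 ^ c dvd n. 1 / real n)"
    unfolding w using assms(2) by (intro sum_multiples_ge) (simp add: c_def)
  also have "{n. n \<in> window l \<and> 2 ^ c dvd n} = {n. marked l n}"
    using assms(1) by (auto simp: marked_def spacing)
  finally show ?thesis .
qed

lemma finite_marked: "finite {n. marked l n}"
  by (rule finite_subset [of _ "window l"]) (auto simp: marked_def window_def)

text \<open>
  The numbers with \<open>2\<close>-adic valuation \<open>p\<close> are the odd multiples of \<open>2 ^ p\<close>, and any two consecutive
  ones are \<open>2 ^ (p + 1)\<close> apart.
\<close>

lemma exists_window_with_label:
  assumes "2 ^ p + 2 * p + 2 \<le> m"
  obtains l where "label l = p" "1 \<le> l" "l < m" "m \<le> l + 2 ^ Suc p" "4 * p \<le> 2 ^ l"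
proof -
  define i where "i = (m - 1 - 2 ^ p) div 2 ^ Suc p"
  define l where "l = (2::nat) ^ p * (2 * i + 1)"
  have l: "l = 2 ^ Suc p * i + 2 ^ p" by (simp add: l_def algebra_simps)
  have "m - 1 - 2 ^ p = 2 ^ Suc p * i + (m - 1 - 2 ^ p) mod 2 ^ Suc p"
    unfolding i_def by simp
  moreover have "(m - 1 - 2 ^ p) mod 2 ^ Suc p < (2::nat) ^ Suc p" by simp
  ultimately have b: "l < m" "m \<le> l + 2 ^ Suc p" using assms l by linarith+
  have "2 ^ p \<le> l" using l by simp
  then have "(2::nat) ^ 2 ^ p \<le> 2 ^ l" by (intro power_increasing) auto
  moreover have "4 * p \<le> 2 ^ 2 ^ p"
  proof -
    consider "p = 0" | "p = 1" | q where "p = Suc (Suc q)"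
      by (metis One_nat_def not0_implies_Suc)
    then show ?thesis
    proof cases
      case 3
      have "p + 2 \<le> 2 ^ p" using 3 Suc_le_power2 [of q] by simp
      then have "(2::nat) ^ (p + 2) \<le> 2 ^ 2 ^ p" by (intro power_increasing) auto
      moreover have "4 * p \<le> 2 ^ (p + 2)" using less_exp [of p] by simp
      ultimately show ?thesis by linarith
    qed auto
  qed
  ultimately have "4 * p \<le> 2 ^ l" by linarith
  moreover have "1 \<le> l" using \<open>2 ^ p \<le> l\<close> by (metis le_trans one_le_numeral one_le_power)
  ultimately show thesis using that b label_power2_mult_odd [of p i] by (simp add: l_def)
qed

text \<open>
  If \<open>N\<close> is between \<open>2 ^ 2 ^ m\<close> and \<open>2 ^ 2 ^ (m + 1)\<close>, then the total mass is at most \<open>2 ^ (m + 1)\<close>,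
  and the last window labelled \<open>p\<close> that ends before \<open>2 ^ 2 ^ m\<close> has a number \<open>l\<close> for which \<open>m - l\<close>
  is bounded. Its marked points alone have mass of order \<open>2 ^ l\<close>.
\<close>

lemma lower_log_density_pos:
  assumes "\<And>l n. label l = p \<Longrightarrow> marked l n \<Longrightarrow> n \<in> E"
  shows "0 < lower_log_density E"
proof -
  define c :: real where "c = 1 / (2 ^ (2 ^ Suc p + 3) * real (spacing p))"
  have c0: "0 < c" using spacing_ge(1) [of p] by (simp add: c_def)
  have "c \<le> (\<Sum>k=1..N. 1 / real k * indicator E k) / (\<Sum>j=1..N. 1 / real j)"
    if N: "2 ^ 2 ^ (2 ^ p + 2 * p + 2) \<le> N" for N
  proof -
    have N1: "1 \<le> N" using N by (metis le_trans one_le_numeral one_le_power)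
    obtain m where m: "2 ^ 2 ^ m \<le> N" "N < 2 ^ 2 ^ Suc m" "2 ^ p + 2 * p + 2 \<le> m"
    proof -
      let ?P = "\<lambda>m. 2 ^ 2 ^ m \<le> N"
      define m where "m = (GREATEST m. ?P m)"
      have bd: "\<And>y. ?P y \<Longrightarrow> y \<le> N"
        by (meson le_trans less_exp less_imp_le)
      have "?P m" unfolding m_def by (rule GreatestI_nat [of ?P, OF N bd])
      moreover have "\<not> ?P (Suc m)"
        using Greatest_le_nat [of ?P "Suc m", OF _ bd] unfolding m_def [symmetric] by auto
      moreover have "2 ^ p + 2 * p + 2 \<le> m"
        using Greatest_le_nat [of ?P, OF N bd] unfolding m_def .
      ultimately show thesis using that by simp
    qed
    obtain l where l: "label l = p" "1 \<le> l" "l < m" "m \<le> l + 2 ^ Suc p" "4 * p \<le> 2 ^ l"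
      using exists_window_with_label [OF m(3)] by blast
    have H: "(\<Sum>j=1..N. 1 / real j) \<le> 2 ^ Suc m"
    proof -
      have "(\<Sum>j=1..N. 1 / real j) \<le> (\<Sum>j\<in>{1..<2 ^ 2 ^ Suc m}. 1 / real j)"
        using m(2) by (intro sum_mono2) auto
      also have "\<dots> \<le> real (2 ^ Suc m)" by (rule harmonic_sum_le)
      finally show ?thesis by simp
    qed
    have Hpos: "0 < (\<Sum>j=1..N. 1 / real j)" using N1 by (intro sum_pos) auto
    have "c * (\<Sum>j=1..N. 1 / real j) \<le> c * 2 ^ Suc m"
      using H c0 by (intro mult_left_mono) auto
    also have "\<dots> \<le> c * 2 ^ Suc (l + 2 ^ Suc p)"
      using l(4) c0 by (intro mult_left_mono power_increasing) auto
    also have "\<dots> = 2 ^ l / (4 * real (spacing p))" by (simp add: c_def power_add)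
    also have "\<dots> \<le> (\<Sum>n | marked l n. 1 / real n)" using sum_marked_ge [of l] l by simp
    also have "\<dots> = (\<Sum>n | marked l n. 1 / real n * indicator E n)"
      using assms l(1) by (intro sum.cong) auto
    also have "\<dots> \<le> (\<Sum>k=1..N. 1 / real k * indicator E k)"
    proof (rule sum_mono2)
      show "{n. marked l n} \<subseteq> {1..N}"
      proof
        fix n assume "n \<in> {n. marked l n}"
        then have n: "2 ^ (2 ^ l + l) \<le> n" "n < 2 ^ 2 ^ Suc l"
          by (auto simp: marked_def window_def simp del: power_Suc)
        have "(2::nat) ^ 2 ^ Suc l \<le> 2 ^ 2 ^ m" using l(3) by (intro power_increasing) auto
        moreover have "1 \<le> n" using n(1) by (metis le_trans one_le_numeral one_le_power)
        ultimately show "n \<in> {1..N}" using n(2) m(1) unfolding atLeastAtMost_iff by linarith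
      qed
    qed auto
    finally show ?thesis using Hpos by (simp add: field_simps)
  qed
  then have "\<forall>\<^sub>F N in sequentially.
      ereal c \<le> ereal ((\<Sum>k=1..N. 1 / real k * indicator E k) / (\<Sum>j=1..N. 1 / real j))"
    unfolding eventually_sequentially by (metis ereal_less_eq(3))
  then have "ereal c \<le> lower_log_density E"
    unfolding lower_log_density_def by (rule Liminf_bounded)
  then show ?thesis using c0 by (metis ereal_less(2) less_le_trans)
qed

section \<open>The backward shift on a weighted space of null sequences\<close>

definition weight :: "nat \<Rightarrow> real" where
  "weight n = 1 / 2 ^ height n"

lemma weight_pos: "0 < weight n"
  and weight_le_1: "weight n \<le> 1"
  and weight_le_2_Suc: "weight n \<le> 2 * weight (Suc n)"
proof -
  have "(2::real) ^ height (Suc n) \<le> 2 ^ Suc (height n)"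
    using height_Suc_le by (intro power_increasing) auto
  then show "weight n \<le> 2 * weight (Suc n)" by (simp add: weight_def field_simps)
qed (auto simp: weight_def)

definition wc0 :: "(nat \<Rightarrow> 'k::real_normed_field) set" where
  "wc0 = {x. (\<lambda>n. weight n * norm (x n)) \<longlonglongrightarrow> 0}"

text \<open>
  The value outside of \<open>wc0\<close>, where the supremum need not exist, only serves to make the induced
  distance nonnegative and symmetric everywhere.
\<close>

definition wnorm :: "(nat \<Rightarrow> 'k::real_normed_field) \<Rightarrow> real" where
  "wnorm x = (if x \<in> wc0 then (SUP n. weight n * norm (x n)) else 0)"

lemma wc0_bdd_above: "x \<in> wc0 \<Longrightarrow> bdd_above (range (\<lambda>n. weight n * norm (x n)))"
  unfolding wc0_def mem_Collect_eq by (rule Bseq_bdd_above [OF convergent_imp_Bseq [OF convergentI]])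

lemma weight_norm_le_wnorm: "x \<in> wc0 \<Longrightarrow> weight n * norm (x n) \<le> wnorm x"
  using cSUP_upper [OF UNIV_I wc0_bdd_above, of x n] by (simp add: wnorm_def)

lemma wnorm_le: "(\<And>n. weight n * norm (x n) \<le> c) \<Longrightarrow> x \<in> wc0 \<Longrightarrow> wnorm x \<le> c"
  unfolding wnorm_def by (auto intro: cSUP_least)

lemma wnorm_nonneg: "0 \<le> wnorm x"
proof (cases "x \<in> wc0")
  case True
  have "0 \<le> weight 0 * norm (x 0)" using weight_pos [of 0] by simp
  then show ?thesis using weight_norm_le_wnorm [OF True, of 0] by linarith
qed (simp add: wnorm_def)

lemma wc0_I:
  assumes "\<And>e. 0 < e \<Longrightarrow> \<exists>n0. \<forall>n\<ge>n0. weight n * norm (x n) < e"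
  shows "x \<in> wc0"
proof -
  have "\<bar>weight n\<bar> = weight n" for n using weight_pos [of n] by simp
  then show ?thesis unfolding wc0_def lim_sequentially
    using assms by (simp add: dist_real_def abs_mult)
qed

lemma wc0_add: "x \<in> wc0 \<Longrightarrow> y \<in> wc0 \<Longrightarrow> x + y \<in> wc0"
proof -
  assume "x \<in> wc0" "y \<in> wc0"
  then have "(\<lambda>n. weight n * norm (x n) + weight n * norm (y n)) \<longlonglongrightarrow> 0"
    unfolding wc0_def by (auto intro: tendsto_add_zero)
  moreover have "norm (weight n * norm ((x + y) n)) \<le> weight n * norm (x n) + weight n * norm (y n)" for n
  proof -
    have "weight n * norm (x n + y n) \<le> weight n * (norm (x n) + norm (y n))"
      using weight_pos [of n] norm_triangle_ineq by (intro mult_left_mono) auto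
    then show ?thesis using weight_pos [of n] by (simp add: distrib_left)
  qed
  ultimately have "(\<lambda>n. weight n * norm ((x + y) n)) \<longlonglongrightarrow> 0"
    by (rule Lim_null_comparison [OF always_eventually [OF allI], rotated])
  then show ?thesis by (simp add: wc0_def)
qed

lemma wc0_scale: "x \<in> wc0 \<Longrightarrow> seq_scale c x \<in> wc0"
  unfolding wc0_def
  by (auto simp: seq_scale_def norm_mult mult.left_commute [of _ "norm c"]
      dest: tendsto_mult_right_zero [where c = "norm c"])

text \<open>
  A Cauchy sequence converges in each coordinate, and the bounds on the differences, being uniform in
  the coordinate, pass to the limit. Approximation by a single member of the sequence then shows that
  the limit is in the space.
\<close>

lemma wc0_complete:
  fixes f :: "nat \<Rightarrow> nat \<Rightarrow> 'k::{real_normed_field, complete_space}"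
  assumes f: "range f \<subseteq> wc0"
    and Cauchy: "\<And>e. 0 < e \<Longrightarrow> \<exists>n0. \<forall>m\<ge>n0. \<forall>n\<ge>n0. wnorm (f m - f n) < e"
  shows "\<exists>x\<in>wc0. (\<lambda>n. wnorm (f n - x)) \<longlonglongrightarrow> 0"
proof -
  have diff: "f m - f n \<in> wc0" for m n
  proof -
    have "f m + seq_scale (-1) (f n) \<in> wc0" using f by (intro wc0_add wc0_scale) auto
    moreover have "f m + seq_scale (-1) (f n) = f m - f n" by (auto simp: seq_scale_def)
    ultimately show ?thesis by simp
  qed
  have coord: "\<exists>n0. \<forall>m\<ge>n0. \<forall>n\<ge>n0. \<forall>k. weight k * norm (f m k - f n k) < e" if e: "0 < e" for e
  proof -
    obtain n0 where n0: "\<And>m n. m \<ge> n0 \<Longrightarrow> n \<ge> n0 \<Longrightarrow> wnorm (f m - f n) < e"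
      using Cauchy e by meson
    have "weight k * norm (f m k - f n k) < e" if "m \<ge> n0" "n \<ge> n0" for m n k
      using weight_norm_le_wnorm [OF diff, of k m n] n0 [OF that] by simp
    then show ?thesis by blast
  qed
  have "Cauchy (\<lambda>n. f n k)" for k
  proof (rule metric_CauchyI)
    fix e :: real assume "0 < e"
    then have "0 < weight k * e" using weight_pos by simp
    then obtain n0 where
      n0: "\<And>m n. m \<ge> n0 \<Longrightarrow> n \<ge> n0 \<Longrightarrow> weight k * norm (f m k - f n k) < weight k * e"
      using coord by meson
    have "dist (f m k) (f n k) < e" if "m \<ge> n0" "n \<ge> n0" for m n
      using n0 [OF that] weight_pos [of k] by (simp add: dist_norm)
    then show "\<exists>M. \<forall>m\<ge>M. \<forall>n\<ge>M. dist (f m k) (f n k) < e" by blast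
  qed
  then have "\<exists>l. (\<lambda>n. f n k) \<longlonglongrightarrow> l" for k
    by (simp add: Cauchy_convergent_iff convergent_def)
  then obtain x where x: "\<And>k. (\<lambda>n. f n k) \<longlonglongrightarrow> x k" by metis
  have close: "\<exists>n0. \<forall>m\<ge>n0. \<forall>k. weight k * norm (f m k - x k) \<le> e" if e: "0 < e" for e
  proof -
    obtain n0 where n0: "\<And>m n k. m \<ge> n0 \<Longrightarrow> n \<ge> n0 \<Longrightarrow> weight k * norm (f m k - f n k) < e"
      using coord [OF e] by blast
    have "weight k * norm (f m k - x k) \<le> e" if "m \<ge> n0" for m k
    proof (rule tendsto_upperbound)
      show "(\<lambda>n. weight k * norm (f m k - f n k)) \<longlonglongrightarrow> weight k * norm (f m k - x k)"
        by (intro tendsto_intros x)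
      show "\<forall>\<^sub>F n in sequentially. weight k * norm (f m k - f n k) \<le> e"
        unfolding eventually_sequentially using n0 that by (meson less_imp_le)
    qed simp
    then show ?thesis by blast
  qed
  have "x \<in> wc0"
  proof (rule wc0_I)
    fix e :: real assume e: "0 < e"
    then obtain m where m: "\<And>k. weight k * norm (f m k - x k) \<le> e / 2"
      using close [of "e / 2"] by auto
    have "(\<lambda>k. weight k * norm (f m k)) \<longlonglongrightarrow> 0" using f unfolding wc0_def by auto
    then have "\<forall>\<^sub>F k in sequentially. weight k * norm (f m k) < e / 2"
      using e by (intro order_tendstoD) auto
    then obtain n0 where n0: "\<And>k. k \<ge> n0 \<Longrightarrow> weight k * norm (f m k) < e / 2"
      unfolding eventually_sequentially by blast
    have "weight k * norm (x k) < e" if "k \<ge> n0" for k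
    proof -
      have "norm (x k) \<le> norm (f m k) + norm (f m k - x k)"
        by (metis norm_minus_commute norm_triangle_sub)
      then have "weight k * norm (x k) \<le> weight k * (norm (f m k) + norm (f m k - x k))"
        using weight_pos [of k] by (intro mult_left_mono) auto
      then show ?thesis using n0 [OF that] m [of k] by (simp add: distrib_left)
    qed
    then show "\<exists>n0. \<forall>k\<ge>n0. weight k * norm (x k) < e" by blast
  qed
  have diffx: "f m - x \<in> wc0" for m
  proof -
    have "f m + seq_scale (-1) x \<in> wc0" using f \<open>x \<in> wc0\<close> by (intro wc0_add wc0_scale) auto
    moreover have "f m + seq_scale (-1) x = f m - x" by (auto simp: seq_scale_def)
    ultimately show ?thesis by simp
  qed
  have "(\<lambda>n. wnorm (f n - x)) \<longlonglongrightarrow> 0"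
    unfolding lim_sequentially
  proof (intro allI impI)
    fix e :: real assume e: "0 < e"
    then obtain n0 where n0: "\<And>m k. m \<ge> n0 \<Longrightarrow> weight k * norm (f m k - x k) \<le> e / 2"
      using close [of "e / 2"] by auto
    have "wnorm (f m - x) < e" if "m \<ge> n0" for m
      using wnorm_le [OF _ diffx, of m "e / 2"] n0 [OF that] e by simp
    then show "\<exists>n0. \<forall>n\<ge>n0. dist (wnorm (f n - x)) 0 < e"
      by (auto simp: dist_real_def wnorm_nonneg)
  qed
  with \<open>x \<in> wc0\<close> show ?thesis by blast
qed

interpretation wc0: complete_normed_subspace seq_scale
  "wc0 :: (nat \<Rightarrow> 'k::{real_normed_field, complete_space}) set" wnorm
proof (intro complete_normed_subspace.intro complete_normed_subspace_axioms.intro)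
  show V: "vector_space (seq_scale :: 'k \<Rightarrow> _)" by (rule vector_space_seq_scale)
  interpret vector_space "seq_scale :: 'k \<Rightarrow> _" by (rule V)
  show S: "subspace wc0"
    by (rule subspaceI) (auto simp: wc0_add wc0_scale, simp add: wc0_def)
  fix x y :: "nat \<Rightarrow> 'k" and c :: 'k
  show "0 \<le> wnorm x" by (rule wnorm_nonneg)
  have "- x \<in> wc0 \<longleftrightarrow> x \<in> wc0" by (simp add: wc0_def)
  then show "wnorm (- x) = wnorm x" by (simp add: wnorm_def)
  show "wnorm x = 0 \<longleftrightarrow> x = 0" if x: "x \<in> wc0"
  proof
    assume "wnorm x = 0"
    then have "weight n * norm (x n) \<le> 0" for n using weight_norm_le_wnorm [OF x, of n] by simp
    then have "x n = 0" for n by (metis mult_le_0_iff norm_le_zero_iff not_le weight_pos)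
    then show "x = 0" by auto
  next
    assume "x = 0"
    then have "wnorm x \<le> 0" using x by (intro wnorm_le) auto
    then show "wnorm x = 0" using wnorm_nonneg [of x] by simp
  qed
  show "wnorm (x + y) \<le> wnorm x + wnorm y" if xy: "x \<in> wc0" "y \<in> wc0"
  proof (rule wnorm_le)
    fix n
    have "weight n * norm ((x + y) n) \<le> weight n * (norm (x n) + norm (y n))"
      using weight_pos [of n] by (intro mult_left_mono) (auto simp: norm_triangle_ineq)
    then show "weight n * norm ((x + y) n) \<le> wnorm x + wnorm y"
      using weight_norm_le_wnorm [OF xy(1), of n] weight_norm_le_wnorm [OF xy(2), of n]
      by (simp add: distrib_left)
  qed (use xy in \<open>simp add: wc0_add\<close>)
  have scale_le: "wnorm (seq_scale c x) \<le> norm c * wnorm x" if x: "x \<in> wc0" for c x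
  proof (rule wnorm_le)
    fix n
    have "norm c * (weight n * norm (x n)) \<le> norm c * wnorm x"
      using weight_norm_le_wnorm [OF x] by (intro mult_left_mono) auto
    then show "weight n * norm (seq_scale c x n) \<le> norm c * wnorm x"
      by (simp add: seq_scale_def norm_mult mult.left_commute)
  qed (use x in \<open>simp add: wc0_scale\<close>)
  show "wnorm (seq_scale c x) = norm c * wnorm x" if x: "x \<in> wc0"
  proof (rule antisym)
    show "norm c * wnorm x \<le> wnorm (seq_scale c x)"
    proof (cases "c = 0")
      case False
      have "x = seq_scale (inverse c) (seq_scale c x)"
        using False by (simp add: seq_scale_def mult.assoc [symmetric])
      then have "wnorm x \<le> norm (inverse c) * wnorm (seq_scale c x)"
        using scale_le [of "seq_scale c x" "inverse c"] x wc0_scale by metis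
      then have "norm c * wnorm x \<le> norm c * (norm (inverse c) * wnorm (seq_scale c x))"
        by (rule mult_left_mono) simp
      also have "\<dots> = norm (c * inverse c) * wnorm (seq_scale c x)"
        by (simp only: norm_mult mult.assoc)
      also have "\<dots> = wnorm (seq_scale c x)" using False by simp
      finally show ?thesis .
    qed (use wnorm_nonneg in simp)
  qed (use scale_le x in blast)
next
  fix f :: "nat \<Rightarrow> nat \<Rightarrow> 'k"
  assume "range f \<subseteq> wc0" "\<And>e. 0 < e \<Longrightarrow> \<exists>n0. \<forall>m\<ge>n0. \<forall>n\<ge>n0. wnorm (f m - f n) < e"
  then show "\<exists>x\<in>wc0. (\<lambda>n. wnorm (f n - x)) \<longlonglongrightarrow> 0" by (rule wc0_complete)
qed

definition back_shift :: "(nat \<Rightarrow> 'k) \<Rightarrow> nat \<Rightarrow> 'k" where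
  "back_shift x = (\<lambda>n. x (Suc n))"

lemma funpow_back_shift: "(back_shift ^^ n) x = (\<lambda>k. x (n + k))"
  by (induction n) (auto simp: back_shift_def)

lemma weight_norm_back_shift_le:
  "weight n * norm (back_shift x n) \<le> 2 * (weight (Suc n) * norm (x (Suc n)))"
  using mult_right_mono [OF weight_le_2_Suc [of n] norm_ge_zero [of "x (Suc n)"]]
  by (simp add: back_shift_def mult.assoc)

lemma back_shift_wc0: "x \<in> wc0 \<Longrightarrow> back_shift x \<in> wc0"
proof -
  assume "x \<in> wc0"
  then have "(\<lambda>n. weight (Suc n) * norm (x (Suc n))) \<longlonglongrightarrow> 0"
    unfolding wc0_def by (auto dest: LIMSEQ_Suc)
  then have "(\<lambda>n. 2 * (weight (Suc n) * norm (x (Suc n)))) \<longlonglongrightarrow> 0"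
    by (rule tendsto_mult_right_zero)
  moreover have "norm (weight n * norm (back_shift x n)) \<le> 2 * (weight (Suc n) * norm (x (Suc n)))" for n
    using weight_norm_back_shift_le [of n x] weight_pos [of n] by simp
  ultimately have "(\<lambda>n. weight n * norm (back_shift x n)) \<longlonglongrightarrow> 0"
    by (rule Lim_null_comparison [OF always_eventually [OF allI], rotated])
  then show ?thesis by (simp add: wc0_def)
qed

lemma back_shift_continuous_linear:
  "continuous_linear_operator (seq_scale :: 'k \<Rightarrow> _)
    (wc0.mtopology :: (nat \<Rightarrow> 'k::{real_normed_field, complete_space}) topology) back_shift"
  unfolding continuous_linear_operator_def
proof (intro conjI)
  have "wnorm (back_shift x) \<le> 2 * wnorm x" if x: "x \<in> wc0" for x :: "nat \<Rightarrow> 'k"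
  proof (rule wnorm_le)
    show "weight n * norm (back_shift x n) \<le> 2 * wnorm x" for n
      using weight_norm_back_shift_le [of n x] weight_norm_le_wnorm [OF x, of "Suc n"] by linarith
  qed (use x back_shift_wc0 in blast)
  then show "continuous_map wc0.mtopology wc0.mtopology (back_shift :: (nat \<Rightarrow> 'k) \<Rightarrow> _)"
    by (intro wc0.continuous_map_linear [where C = 2] back_shift_wc0)
      (auto simp: back_shift_def)
qed (auto simp: back_shift_def seq_scale_def)

text \<open>
  The ball around the first unit vector is so small that every iterate in it has a coordinate \<open>0\<close> of
  norm more than \<open>1 / 2\<close>.
\<close>

lemma not_frequently_hypercyclic_back_shift:
  "\<not> frequently_hypercyclic
    (wc0.mtopology :: (nat \<Rightarrow> 'k::{real_normed_field, complete_space}) topology) back_shift"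
proof
  assume "frequently_hypercyclic (wc0.mtopology :: (nat \<Rightarrow> 'k) topology) back_shift"
  then obtain x :: "nat \<Rightarrow> 'k" where x: "x \<in> wc0"
    and fhc: "\<And>U. openin wc0.mtopology U \<Longrightarrow> U \<noteq> {} \<Longrightarrow>
      0 < lower_density {n. n \<ge> 1 \<and> (back_shift ^^ n) x \<in> U}"
    unfolding frequently_hypercyclic_def by auto
  define y :: "nat \<Rightarrow> 'k" where "y = (\<lambda>n. if n = 0 then 1 else 0)"
  have y: "y \<in> wc0"
    by (rule wc0_I) (auto simp: y_def intro!: exI [of _ 1])
  define r where "r = weight 0 / 2"
  have r: "0 < r" using weight_pos [of 0] by (simp add: r_def)
  define E where "E = {n. n \<ge> 1 \<and> (back_shift ^^ n) x \<in> wc0.mball y r}"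
  have large: "1 / 2 < norm (x n)" if "n \<in> E" for n
  proof -
    let ?z = "(back_shift ^^ n) x"
    have z: "?z \<in> wc0" "wnorm (y - ?z) < r" using that by (auto simp: E_def)
    have "y - ?z \<in> wc0" using y z by simp
    then have "weight 0 * norm (1 - x n) < weight 0 * (1 / 2)"
      using weight_norm_le_wnorm [of "y - ?z" 0] z(2)
      by (simp add: r_def y_def funpow_back_shift)
    then have "norm (1 - x n) < 1 / 2" using weight_pos [of 0] by (simp only: mult_less_cancel_left_pos)
    moreover have "norm (1::'k) \<le> norm (x n) + norm (1 - x n)" by (metis norm_triangle_sub)
    ultimately show ?thesis by simp
  qed
  have "finite {n \<in> E. height n < h}" for h
  proof -
    have "0 < 1 / (2::real) ^ Suc h" by simp
    moreover have "(\<lambda>n. weight n * norm (x n)) \<longlonglongrightarrow> 0" using x by (simp add: wc0_def)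
    ultimately have "\<forall>\<^sub>F n in sequentially. weight n * norm (x n) < 1 / 2 ^ Suc h"
      by (intro order_tendstoD(2))
    then obtain n0 where n0: "\<And>n. n \<ge> n0 \<Longrightarrow> weight n * norm (x n) < 1 / 2 ^ Suc h"
      unfolding eventually_sequentially by blast
    have "n < n0" if "n \<in> E" "height n < h" for n
    proof (rule ccontr)
      assume "\<not> n < n0"
      then have "weight n * norm (x n) < 1 / 2 ^ Suc h" using n0 by simp
      moreover have "weight n * (1 / 2) \<le> weight n * norm (x n)"
        using large [OF that(1)] weight_pos [of n] by (intro mult_left_mono) auto
      moreover have "1 / 2 ^ Suc h \<le> weight n * (1 / 2)"
      proof -
        have "(2::real) ^ height n \<le> 2 ^ h" using that(2) by (intro power_increasing) auto
        then show ?thesis by (simp add: weight_def field_simps)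
      qed
      ultimately show False by linarith
    qed
    then show ?thesis by (auto intro: finite_subset [of _ "{..<n0}", OF _ finite_lessThan])
  qed
  then have "lower_density E \<le> 0" by (rule lower_density_le_0_if_height_to_infinity)
  moreover have "y \<in> wc0.mball y r" using y r by simp
  then have "0 < lower_density E" unfolding E_def by (intro fhc) auto
  ultimately show False by simp
qed

section \<open>A log-frequently hypercyclic vector\<close>

text \<open>
  Growth and support of the \<open>p\<close>-th vector are limited so that a request of height \<open>p + q\<close> at a copy
  of the \<open>q\<close>-th vector leaves a weighted norm of at most \<open>1 / 2 ^ p\<close>.
\<close>

definition is_target :: "nat \<Rightarrow> (nat \<Rightarrow> 'k::real_normed_field) \<Rightarrow> bool" where
  "is_target p y \<longleftrightarrow> (\<forall>t. norm (y t) \<le> 2 ^ p) \<and> (\<forall>t>p. y t = 0)"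

lemma finite_support_wc0: "(\<And>t. t > p \<Longrightarrow> y t = 0) \<Longrightarrow> y \<in> wc0"
  by (rule wc0_I) (auto intro!: exI [of _ "Suc p"])

text \<open>
  Finitely supported sequences with entries in a countable dense set are enumerated with infinitely
  many repetitions, so that each of them occurs at an index large enough to make it an admissible
  target; inadmissible occurrences are replaced by \<open>0\<close>.
\<close>

lemma exists_dense_targets:
  obtains y :: "nat \<Rightarrow> nat \<Rightarrow> 'k::{real_normed_field, euclidean_space}"
  where "\<And>p. is_target p (y p)"
    and "\<And>x e q. x \<in> wc0 \<Longrightarrow> 0 < e \<Longrightarrow> \<exists>p\<ge>q. wnorm (y p - x) < e"
proof -
  obtain D :: "'k set" where D: "countable D" "\<And>X. open X \<Longrightarrow> X \<noteq> {} \<Longrightarrow> \<exists>d\<in>D. d \<in> X"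
    using countable_dense_exists by blast
  define z :: "'k list \<Rightarrow> nat \<Rightarrow> 'k" where "z = (\<lambda>ds t. if t < length ds then ds ! t else 0)"
  define w where "w = (\<lambda>p. z (from_nat_into (lists D) (fst (prod_decode p))))"
  define y where "y = (\<lambda>p. if is_target p (w p) then w p else (\<lambda>_. 0))"
  have target: "is_target p (y p)" for p by (auto simp: y_def is_target_def)
  have dense: "\<exists>p\<ge>q. wnorm (y p - x) < e" if x: "x \<in> wc0" and e: "0 < e" for x e q
  proof -
    have "(\<lambda>n. weight n * norm (x n)) \<longlonglongrightarrow> 0" using x by (simp add: wc0_def)
    then have "\<forall>\<^sub>F n in sequentially. weight n * norm (x n) < e / 2"
      using e by (intro order_tendstoD) auto
    then obtain K where K: "\<And>n. n \<ge> K \<Longrightarrow> weight n * norm (x n) < e / 2"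
      unfolding eventually_sequentially by blast
    have "\<exists>d\<in>D. dist (x t) d < e / 2" for t
      using D(2) [of "ball (x t) (e / 2)"] e by auto
    then obtain d where d: "\<And>t. d t \<in> D" "\<And>t. dist (x t) (d t) < e / 2" by metis
    define ds where "ds = map d [0..<K]"
    have "ds \<in> lists D" using d(1) by (auto simp: ds_def)
    moreover have "countable (lists D)" using D(1) by (rule countable_lists)
    ultimately obtain i where i: "from_nat_into (lists D) i = ds"
      by (metis from_nat_into_surj)
    obtain b :: nat where b: "(\<Sum>t<K. norm (d t)) \<le> real b" using real_arch_simple by blast
    define p where "p = prod_encode (i, q + K + b)"
    have p: "q + K + b \<le> p" by (simp add: p_def le_prod_encode_2)
    have w: "w p = (\<lambda>t. if t < K then d t else 0)"
      by (auto simp: w_def p_def i z_def ds_def)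
    have "norm (d t) \<le> 2 ^ p" if "t < K" for t
    proof -
      have "norm (d t) \<le> (\<Sum>t<K. norm (d t))" using that by (intro member_le_sum) auto
      also have "\<dots> \<le> real p" using b p by linarith
      also have "\<dots> \<le> 2 ^ p" by (rule less_imp_le [OF of_nat_less_two_power])
      finally show ?thesis .
    qed
    then have yp: "y p = (\<lambda>t. if t < K then d t else 0)"
      using p by (auto simp: y_def is_target_def w)
    have "y p - x \<in> wc0"
    proof -
      have "y p \<in> wc0" using p by (intro finite_support_wc0 [of K]) (auto simp: yp)
      then show ?thesis using x by simp
    qed
    then have "wnorm (y p - x) \<le> e / 2"
    proof (rule wnorm_le [rotated])
      fix t
      show "weight t * norm ((y p - x) t) \<le> e / 2"
      proof (cases "t < K")
        case True
        have "weight t * norm (d t - x t) \<le> 1 * norm (d t - x t)"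
          using weight_le_1 by (intro mult_right_mono) auto
        then show ?thesis using True d(2) [of t] by (simp add: yp dist_norm norm_minus_commute)
      next
        case False
        then show ?thesis using K [of t] by (simp add: yp)
      qed
    qed
    then show ?thesis using p e by (intro exI [of _ p]) auto
  qed
  show thesis using that target dense .
qed

text \<open>
  The copies of \<open>y (label l)\<close> at the marked points \<open>n\<close>. The choice is unique, because these copies do
  not overlap.
\<close>

definition glue :: "(nat \<Rightarrow> nat \<Rightarrow> 'k::zero) \<Rightarrow> nat \<Rightarrow> 'k" where
  "glue y k = (if \<exists>l n. marked l n \<and> n \<le> k \<and> k \<le> n + label l
    then (case SOME (l, n). marked l n \<and> n \<le> k \<and> k \<le> n + label l of (l, n) \<Rightarrow> y (label l) (k - n))
    else 0)"

lemma glue_eq: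
  assumes "marked l n" "t \<le> label l"
  shows "glue y (n + t) = y (label l) t"
proof -
  let ?P = "\<lambda>l' n'. marked l' n' \<and> n' \<le> n + t \<and> n + t \<le> n' + label l'"
  have P: "?P l n" using assms by simp
  have "(SOME (l', n'). ?P l' n') = (l, n)"
    using P marked_block_unique by (intro some_equality) fastforce+
  moreover have "\<exists>l' n'. ?P l' n'" using P by blast
  ultimately show ?thesis by (simp add: glue_def)
qed

lemma glue_nonzeroE:
  assumes "glue y k \<noteq> 0"
  obtains l n t where "marked l n" "t \<le> label l" "k = n + t" "glue y k = y (label l) t"
proof -
  obtain l n where ln: "marked l n" "n \<le> k" "k \<le> n + label l"
    using assms unfolding glue_def by (auto split: if_splits)
  then have "glue y (n + (k - n)) = y (label l) (k - n)" by (intro glue_eq) auto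
  then show thesis using that [of l n "k - n"] ln by simp
qed

lemma weight_high:
  assumes "high h n" "q \<le> h"
  shows "weight n * 2 ^ q \<le> 1 / 2 ^ (h - q)"
proof -
  have "h \<le> height n" using le_height [of h 0 n] assms(1) by simp
  then have "(2::real) ^ h \<le> 2 ^ height n" by (intro power_increasing) auto
  moreover have "(2::real) ^ h = 2 ^ q * 2 ^ (h - q)" using assms(2) by (simp flip: power_add)
  ultimately show ?thesis by (simp add: weight_def field_simps)
qed

text \<open>
  A copy in the \<open>l\<close>-th window has entries of norm at most \<open>2 ^ label l\<close>, with \<open>label l \<le> l\<close>, at places
  of height at least \<open>2 * l\<close>.
\<close>

lemma glue_wc0:
  assumes y: "\<And>p. is_target p (y p)"
  shows "glue y \<in> wc0"
proof (rule wc0_I)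
  fix e :: real assume "0 < e"
  then obtain L :: nat where L: "1 / e < 2 ^ L" using real_arch_pow [of 2 "1 / e"] by auto
  then have L': "1 / 2 ^ L < e" using \<open>0 < e\<close> by (simp add: field_simps)
  have "weight k * norm (glue y k) < e" if k: "2 ^ Suc (2 ^ Suc L) < k" for k
  proof (cases "glue y k = 0")
    case False
    then obtain l n t where g: "marked l n" "t \<le> label l" "k = n + t" "glue y k = y (label l) t"
      by (rule glue_nonzeroE)
    have l: "1 \<le> l" "n < 2 ^ 2 ^ Suc l"
      using g(1) by (auto simp: marked_def window_def simp del: power_Suc)
    have "L \<le> l"
    proof (rule ccontr)
      assume "\<not> L \<le> l"
      then have "(2::nat) ^ Suc l \<le> 2 ^ Suc L" by (intro power_increasing) auto
      then have "(2::nat) ^ 2 ^ Suc l \<le> 2 ^ 2 ^ Suc L" by (intro power_increasing) auto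
      moreover have "(2::nat) ^ Suc (2 ^ Suc L) = 2 * 2 ^ 2 ^ Suc L" by (rule power_Suc)
      moreover have "l < 2 ^ 2 ^ Suc l"
        using less_exp [of "Suc l"] less_exp [of "2 ^ Suc l"] by linarith
      ultimately show False using k g(2,3) label_le [OF l(1)] l(2) by linarith
    qed
    have "weight k * norm (glue y k) \<le> weight k * 2 ^ label l"
      using y weight_pos [of k] unfolding g(4) is_target_def by (intro mult_left_mono) auto
    also have "\<dots> \<le> 1 / 2 ^ (2 * l - label l)"
      using high_marked [OF g(1,2)] label_le [OF l(1)] unfolding g(3) by (intro weight_high) auto
    also have "\<dots> \<le> 1 / 2 ^ L"
      using \<open>L \<le> l\<close> label_le [OF l(1)] by (intro divide_left_mono power_increasing) auto
    finally show ?thesis using L' by simp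
  qed (use \<open>0 < e\<close> in simp)
  then show "\<exists>n0. \<forall>n\<ge>n0. weight n * norm (glue y n) < e" by (meson Suc_le_lessD)
qed

lemma funpow_back_shift_wc0: "x \<in> wc0 \<Longrightarrow> (back_shift ^^ n) x \<in> wc0"
  by (induction n) (auto intro: back_shift_wc0)

text \<open>
  The first \<open>label l + 1\<close> coordinates agree, and every later nonzero coordinate of the iterate belongs
  to a copy that starts after \<open>n\<close>, where \<open>high_diff\<close> applies.
\<close>

lemma glue_orbit_close:
  fixes y :: "nat \<Rightarrow> nat \<Rightarrow> 'k::{real_normed_field, complete_space}"
  assumes y: "\<And>p. is_target p (y p)" and "marked l n"
  shows "wnorm (y (label l) - (back_shift ^^ n) (glue y)) \<le> 1 / 2 ^ label l"
proof (rule wnorm_le)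
  have "y (label l) \<in> wc0" using y by (intro finite_support_wc0) (auto simp: is_target_def)
  moreover have "(back_shift ^^ n) (glue y) \<in> wc0"
    using y by (intro funpow_back_shift_wc0 glue_wc0)
  ultimately show "y (label l) - (back_shift ^^ n) (glue y) \<in> wc0" by simp
  fix t
  show "weight t * norm ((y (label l) - (back_shift ^^ n) (glue y)) t) \<le> 1 / 2 ^ label l"
  proof (cases "t \<le> label l \<or> glue y (n + t) = 0")
    case True
    then have "y (label l) t = glue y (n + t)"
      using glue_eq [OF assms(2), of t y] y [of "label l"]
      by (cases "t \<le> label l") (auto simp: is_target_def)
    then show ?thesis by (simp add: funpow_back_shift)
  next
    case False
    then have t: "label l < t" "glue y (n + t) \<noteq> 0" by auto
    obtain l' n' s where g: "marked l' n'" "s \<le> label l'" "n + t = n' + s"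
        "glue y (n + t) = y (label l') s"
      using t(2) by (rule glue_nonzeroE)
    have "n < n'"
    proof (rule ccontr)
      assume "\<not> n < n'"
      then have "l' = l \<and> n' = n"
        using g t by (intro marked_block_unique [OF g(1) assms(2), of n]) auto
      then show False using g t by simp
    qed
    then have t': "t = n' - n + s" using g(3) by simp
    have "(y (label l) - (back_shift ^^ n) (glue y)) t = - y (label l') s"
      using t(1) y [of "label l"] g(4) by (simp add: funpow_back_shift is_target_def)
    then have "weight t * norm ((y (label l) - (back_shift ^^ n) (glue y)) t)
        \<le> weight t * 2 ^ label l'"
      using y [of "label l'"] weight_pos [of t] unfolding is_target_def
      by (intro mult_left_mono) auto
    also have "\<dots> \<le> 1 / 2 ^ (label l + label l' - label l')"
      unfolding t' by (intro weight_high high_diff assms(2) g \<open>n < n'\<close>) simp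
    finally show ?thesis by simp
  qed
qed

lemma log_frequently_hypercyclic_back_shift:
  "log_frequently_hypercyclic
    (wc0.mtopology :: (nat \<Rightarrow> 'k::{real_normed_field, euclidean_space}) topology) back_shift"
proof -
  obtain y :: "nat \<Rightarrow> nat \<Rightarrow> 'k" where y: "\<And>p. is_target p (y p)"
    and dense: "\<And>x e q. x \<in> wc0 \<Longrightarrow> 0 < e \<Longrightarrow> \<exists>p\<ge>q. wnorm (y p - x) < e"
    by (rule exists_dense_targets) blast
  have g: "glue y \<in> wc0" using y by (rule glue_wc0)
  have "0 < lower_log_density {n. n \<ge> 1 \<and> (back_shift ^^ n) (glue y) \<in> U}"
    if U: "openin wc0.mtopology U" "U \<noteq> {}" for U
  proof -
    obtain x where x: "x \<in> U" using U(2) by auto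
    then obtain e where e: "0 < e" "wc0.mball x e \<subseteq> U"
      using U(1) by (auto simp: wc0.openin_mtopology)
    have xw: "x \<in> wc0" using U(1) x wc0.openin_mtopology by blast
    obtain q :: nat where q: "2 / e < 2 ^ q" using real_arch_pow [of 2 "2 / e"] by auto
    obtain p where p: "q \<le> p" "wnorm (y p - x) < e / 2"
      using dense [OF xw, of "e / 2" q] e(1) by auto
    have "(2::real) ^ q \<le> 2 ^ p" using p(1) by (intro power_increasing) auto
    with q have "2 / e < 2 ^ p" by linarith
    then have small: "1 / 2 ^ p < e / 2" using e(1) by (simp add: field_simps)
    have yw: "y p \<in> wc0" using y by (intro finite_support_wc0) (auto simp: is_target_def)
    have "n \<in> {n. n \<ge> 1 \<and> (back_shift ^^ n) (glue y) \<in> U}" if "label l = p" "marked l n" for l n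
    proof -
      let ?z = "(back_shift ^^ n) (glue y)"
      have z: "?z \<in> wc0" using g by (rule funpow_back_shift_wc0)
      have "wnorm (x - ?z) \<le> wnorm (x - y p) + wnorm (y p - ?z)"
        using xw yw z by (rule wc0.triangle)
      also have "wnorm (x - y p) = wnorm (y p - x)" by (rule wc0.commute)
      also have "wnorm (y p - ?z) \<le> 1 / 2 ^ p"
        using glue_orbit_close [OF y that(2)] that(1) by simp
      finally have "wnorm (x - ?z) < e" using p(2) small by linarith
      then have "?z \<in> U" using xw z e(2) by (auto simp: subset_iff)
      moreover have "1 \<le> n"
      proof -
        have "(1::nat) \<le> 2 ^ (2 ^ l + l)" by simp
        moreover have "2 ^ (2 ^ l + l) \<le> n" using that(2) by (simp add: marked_def window_def)
        ultimately show ?thesis by linarith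
      qed
      ultimately show ?thesis by simp
    qed
    then show ?thesis by (rule lower_log_density_pos)
  qed
  with g show ?thesis unfolding log_frequently_hypercyclic_def by auto
qed

theorem theorem4p5:
  shows "\<exists>(X :: (nat \<Rightarrow> 'k::{real_normed_field, euclidean_space}) topology) T.
    frechet_space seq_scale X \<and>
    continuous_linear_operator seq_scale X T \<and>
    log_frequently_hypercyclic X T \<and>
    \<not> frequently_hypercyclic X T"
  using wc0.frechet_space_mtopology back_shift_continuous_linear
    log_frequently_hypercyclic_back_shift not_frequently_hypercyclic_back_shift
  by blast

end
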